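(* Let $m>0$, $\omega>0$, let $s,\ell$ be nonnegative integers with $\ell\ge s$, and let $T_{s,\ell}$ be the greybody factor (transmission probability) at frequency $\omega$ for the Regge--Wheeler potential of a Schwarzschild black hole of mass $m$ (defined in the context). Then, in each case whenever the numerator on the right-hand side is positive: (i) for $s=1$: $\displaystyle T_{1,\ell}\ge\frac{108\,\omega^2m^2[27\omega^2m^2-\ell(\ell+1)]}{[54\omega^2m^2-\ell(\ell+1)]^2}$; (ii) for $s=0,\ \ell=0$: $\displaystyle T_{0,0}\ge\frac{4096\,\omega^2m^2[1024\omega^2m^2-27]}{[2048\omega^2m^2-27]^2}$; (iii) for $s=0,\ \ell\ge1$: $\displaystyle T_{0,\ell}>\frac{108\,\omega^2m^2[27\omega^2m^2-(\ell^2+\ell+1)]}{[54\omega^2m^2-(\ell^2+\ell+1)]^2}$; (iv) for $s>1$: $\displaystyle T_{s,\ell}>\frac{108\,\omega^2m^2[27\omega^2m^2-\ell(\ell+1)]}{[54\omega^2m^2-\ell(\ell+1)]^2}$; (v) for every $(s,\ell)\ne(0,0)$: $\displaystyle T_{s,\ell}>\frac{80\,\omega^2m^2[20\omega^2m^2-\ell(\ell+1)]}{[40\omega^2m^2-\ell(\ell+1)]^2}$.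
   Context: Units $G=c=1$. The tortoise coordinate $r_*\in(-\infty,\infty)$ is $r_*=r+2m\ln\frac{r-2m}{2m}$ for $r\in(2m,\infty)$, so that $dr/dr_*=1-2m/r$. The Regge--Wheeler equation is $\frac{d^2\psi}{dr_*^2}+[\omega^2-V(r)]\psi=0$ with $V(r)=\left(1-\frac{2m}{r}\right)\left[\frac{\ell(\ell+1)}{r^2}+\frac{2m(1-s^2)}{r^3}\right]$, where $r=r(r_* )$. The greybody factor $T_{s,\ell}$ is the transmission probability of this one-dimensional scattering problem on $r_*\in\mathbb{R}$: if the solution with $\psi\sim e^{i\omega r_*}$ as $r_*\to-\infty$ behaves as $\psi\sim\alpha e^{i\omega r_*}+\beta e^{-i\omega r_*}$ as $r_*\to+\infty$, then $T_{s,\ell}=1/|\alpha|^2$. *)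

theory Defs
  imports "HOL-Analysis.Analysis"
begin

definition tortoise :: "real \<Rightarrow> real \<Rightarrow> real" where
  "tortoise m r = r + 2 * m * ln ((r - 2 * m) / (2 * m))"

(* The map "tortoise m" is a bijection from {2 * m<..} onto the real line when m > 0. *)
definition radius_of_tortoise :: "real \<Rightarrow> real \<Rightarrow> real" where
  "radius_of_tortoise m = the_inv_into {2 * m<..} (tortoise m)"

definition regge_wheeler_potential :: "real \<Rightarrow> nat \<Rightarrow> nat \<Rightarrow> real \<Rightarrow> real" where
  "regge_wheeler_potential m s l r =
     (1 - 2 * m / r) *
     (real l * (real l + 1) / r ^ 2 + 2 * m * (1 - (real s) ^ 2) / r ^ 3)"

definition schroedinger_solution :: "real \<Rightarrow> (real \<Rightarrow> real) \<Rightarrow> (real \<Rightarrow> complex) \<Rightarrow> bool" where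
  "schroedinger_solution \<omega> U \<psi> \<longleftrightarrow>
     (\<exists>\<psi>' \<psi>''. \<forall>x. (\<psi> has_vector_derivative \<psi>' x) (at x) \<and>
                 (\<psi>' has_vector_derivative \<psi>'' x) (at x) \<and>
                 \<psi>'' x + of_real (\<omega> ^ 2 - U x) * \<psi> x = 0)"

(* The asymptotic relations are read as "the difference tends to 0", which stays meaningful
   should the combination of plane waves at +infinity have zeros. *)
definition scattering_solution ::
  "real \<Rightarrow> (real \<Rightarrow> real) \<Rightarrow> (real \<Rightarrow> complex) \<Rightarrow> complex \<Rightarrow> complex \<Rightarrow> bool" where
  "scattering_solution \<omega> U \<psi> \<alpha> \<beta> \<longleftrightarrow>
     schroedinger_solution \<omega> U \<psi> \<and>
     ((\<lambda>x. \<psi> x - exp (\<i> * of_real (\<omega> * x))) \<longlongrightarrow> 0) at_bot \<and>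
     ((\<lambda>x. \<psi> x - (\<alpha> * exp (\<i> * of_real (\<omega> * x)) + \<beta> * exp (- \<i> * of_real (\<omega> * x))))
        \<longlongrightarrow> 0) at_top"

definition transmission_probability :: "real \<Rightarrow> (real \<Rightarrow> real) \<Rightarrow> real" where
  "transmission_probability \<omega> U =
     (THE T. \<exists>\<psi> \<alpha> \<beta>. scattering_solution \<omega> U \<psi> \<alpha> \<beta> \<and> T = 1 / (cmod \<alpha>) ^ 2)"

definition greybody_factor :: "real \<Rightarrow> real \<Rightarrow> nat \<Rightarrow> nat \<Rightarrow> real" where
  "greybody_factor m \<omega> s l =
     transmission_probability \<omega> (\<lambda>x. regge_wheeler_potential m s l (radius_of_tortoise m x))"

end

theory Submission
  imports Defs
begin

text \<open>
  Write the solution as \<open>\<psi> = a * exp (\<i> \<omega> x) + b * exp (- \<i> \<omega> x)\<close> with \<open>\<psi>'\<close> equal to the formal derivative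
  for constant \<open>a\<close>, \<open>b\<close>. Flux conservation gives \<open>|a|\<^sup>2 - |b|\<^sup>2 = 1\<close> and hence \<open>|\<psi>| |\<psi>'| \<ge> \<omega>\<close>.
  With \<open>h\<^sup>2 = \<omega>\<^sup>2 - V\<close>, the quantity \<open>F = |\<psi>'|\<^sup>2 / h + h |\<psi>|\<^sup>2\<close> satisfies \<open>|F'| \<le> |h'/h| sqrt (F\<^sup>2 - 4 \<omega>\<^sup>2)\<close>, that is,
  \<open>arcosh (F / (2 \<omega>))\<close> grows by at most the variation of \<open>ln h\<close>. The Regge-Wheeler potential has a single maximum
  \<open>V\<^sub>0\<close>, so this variation is \<open>2 ln (\<omega> / h\<^sub>0)\<close> with \<open>h\<^sub>0\<^sup>2 = \<omega>\<^sup>2 - V\<^sub>0\<close>, and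
  \<open>T \<ge> 4 \<omega>\<^sup>2 h\<^sub>0\<^sup>2 / (\<omega>\<^sup>2 + h\<^sub>0\<^sup>2)\<^sup>2 = 1 - (V\<^sub>0 / (2 \<omega>\<^sup>2 - V\<^sub>0))\<^sup>2\<close>, which decreases in \<open>V\<^sub>0\<close>. In place of the differential
  inequality for \<open>F\<close>, whose right-hand side is singular at \<open>F = 2 \<omega>\<close>, each side of the maximum has a monotone
  quantity with the same conclusion.
\<close>

section \<open>A global existence theorem with bounded coefficients\<close>

text \<open>The field is controlled only on the open interval; at the end points it may oscillate
  without a limit. Picard iteration in integral form asks only for a bounded measurable integrand,
  so the solution still extends continuously to \<open>0\<close> and \<open>A\<close>. The linear
  bound gives both the initial value and the rate at which it is approached.\<close>

lemma lipschitz_ode_solution_exists: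
  fixes c :: "real \<Rightarrow> 'a \<Rightarrow> 'a::euclidean_space" and z0 :: 'a
  assumes A: "A > 0"
    and cont: "continuous_on ({0<..<A} \<times> UNIV) (\<lambda>(t, v). c t v)"
    and lip: "\<And>t v w. t \<in> {0<..<A} \<Longrightarrow> norm (c t v - c t w) \<le> C * norm (v - w)"
    and zero: "\<And>t. t \<in> {0<..<A} \<Longrightarrow> norm (c t 0) \<le> M"
  obtains z B where "continuous_on {0..A} z"
    and "\<And>t. t \<in> {0<..<A} \<Longrightarrow> (z has_vector_derivative c t (z t)) (at t)"
    and "\<And>t. t \<in> {0..A} \<Longrightarrow> norm (z t - z0) \<le> B * t"
proof -
  define d where "d t v = (if t \<in> {0<..<A} then c t v else 0)" for t v
  define C' where "C' = max C 0"
  define M' where "M' = max M 0"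
  \<comment> \<open>Large enough for \<open>C' / k \<le> 1 / 2\<close>, the contraction constant;
    the \<open>+ 1\<close> keeps \<open>k\<close> positive when \<open>C' = 0\<close>.\<close>
  define k where "k = 2 * C' + 1"
  have C': "C' \<ge> 0" "C \<le> C'" and M': "M' \<ge> 0" "M \<le> M'" and k: "k > 0"
    by (auto simp: C'_def M'_def k_def)
  have dlip: "norm (d t v - d t w) \<le> C' * norm (v - w)" for t v w
  proof (cases "t \<in> {0<..<A}")
    case True
    have "norm (c t v - c t w) \<le> C * norm (v - w)" using lip[OF True] .
    also have "\<dots> \<le> C' * norm (v - w)" using C' by (simp add: mult_right_mono)
    finally show ?thesis using True by (simp add: d_def)
  qed (auto simp: d_def C')
  have dgrow: "norm (d t v) \<le> M' + C' * norm v" for t v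
  proof -
    have "norm (d t 0) \<le> M'" using zero[of t] M' by (auto simp: d_def)
    moreover have "norm (d t v) \<le> norm (d t 0) + norm (d t v - d t 0)" 
      by (metis norm_triangle_sub)
    ultimately show ?thesis using dlip[of t v 0] by simp
  qed
  have ccont: "continuous_on {0<..<A} (\<lambda>t. c t (w t))" if "continuous_on {0..A} w" for w :: "real \<Rightarrow> 'a"
  proof -
    have "continuous_on {0<..<A} (\<lambda>t. (\<lambda>(t, v). c t v) (t, w t))"
      by (rule continuous_on_compose2[OF cont])
        (auto intro!: continuous_intros continuous_on_subset[OF that])
    then show ?thesis by simp
  qed
  have dint: "(\<lambda>t. d t (w t)) integrable_on {0..y}"
    if w: "continuous_on {0..A} w" and y: "y \<in> {0..A}" for w y
  proof -
    have "bounded (w ` {0..A})"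
      using compact_continuous_image[OF w] compact_imp_bounded by blast
    then obtain N where N: "\<And>t. t \<in> {0..A} \<Longrightarrow> norm (w t) \<le> N"
      unfolding bounded_iff by blast
    have eq: "(\<lambda>t. d t (w t)) = (\<lambda>t. indicator {0<..<A} t *\<^sub>R c t (w t))"
      by (auto simp: d_def indicator_def)
    \<comment> \<open>Continuity may fail at \<open>0\<close> and \<open>A\<close>, so integrability
      over the closed interval is drawn from measurability and boundedness.\<close>
    have "(\<lambda>t. d t (w t)) \<in> borel_measurable borel"
      unfolding eq by (rule borel_measurable_continuous_on_indicator[OF _ ccont[OF w]]) auto
    then have "(\<lambda>t. d t (w t)) \<in> borel_measurable lebesgue"
      using measurable_completion[of _ lborel] by simp
    then have meas: "(\<lambda>t. d t (w t)) \<in> borel_measurable (lebesgue_on {0..y})"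
      by (rule measurable_restrict_space1)
    show ?thesis
    proof (rule measurable_bounded_by_integrable_imp_integrable[OF meas, of "\<lambda>_. M' + C' * N"])
      fix t assume "t \<in> {0..y}"
      then have "norm (w t) \<le> N" using N y by auto
      then show "norm (d t (w t)) \<le> M' + C' * N"
        using dgrow[of t "w t"] C' by (smt (verit) mult_left_mono)
    qed (auto)
  qed
  \<comment> \<open>The Picard operator conjugated by \<open>exp (k * t)\<close>: this weight makes it a contraction
    on all of \<open>[0, A]\<close>, whatever the size of \<open>C * A\<close>.\<close>
  define P where "P g y = exp (- k * y) *\<^sub>R (z0 + integral {0..y} (\<lambda>t. d t (exp (k * t) *\<^sub>R g t)))" for g y
  have gcont: "continuous_on {0..A} (\<lambda>t. exp (k * t) *\<^sub>R apply_bcontfun g t)" for g :: "real \<Rightarrow>\<^sub>C 'a"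
    by (intro continuous_on_scaleR continuous_on_apply_bcontfun) (intro continuous_intros)
  have Pcont: "continuous_on {0..A} (P (apply_bcontfun g))" for g
    unfolding P_def
    by (intro continuous_intros indefinite_integral_continuous_1 dint gcont) (use A in auto)
  \<comment> \<open>Extending by \<open>clamp\<close> outside \<open>[0, A]\<close> places the
    iterates among the bounded continuous functions on the line, a complete space in which Banach's
    fixed point theorem applies.\<close>
  have "\<exists>h :: real \<Rightarrow>\<^sub>C 'a. \<forall>y. h y = P (apply_bcontfun g) (clamp 0 A y)" for g
    using continuous_on_cbox_bcontfunE[of 0 A "P (apply_bcontfun g)"] Pcont[of g]
    by (metis cbox_interval)
  then obtain T where T: "\<And>g y. apply_bcontfun (T g) y = P (apply_bcontfun g) (clamp 0 A y)"
    by metis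
  have contraction: "dist (T g) (T h) \<le> 1 / 2 * dist g h" for g h
  proof (rule dist_bound)
    fix x :: real
    define y where "y = clamp 0 A x"
    have y: "y \<in> {0..A}" using A clamp_in_interval[of 0 A x] by (auto simp: y_def)
    let ?f = "\<lambda>g t. d t (exp (k * t) *\<^sub>R apply_bcontfun g t)"
    have exp_int: "((\<lambda>t. C' * dist g h * exp (k * t)) has_integral
        (C' * dist g h * exp (k * y) / k - C' * dist g h * exp (k * 0) / k)) {0..y}"
      by (rule fundamental_theorem_of_calculus)
        (use y k in \<open>auto intro!: derivative_eq_intros
          simp flip: has_real_derivative_iff_has_vector_derivative\<close>)
    have "norm (integral {0..y} (\<lambda>t. ?f g t - ?f h t)) \<le> integral {0..y} (\<lambda>t. C' * dist g h * exp (k * t))"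
    proof (rule integral_norm_bound_integral)
      show "(\<lambda>t. ?f g t - ?f h t) integrable_on {0..y}"
        by (intro integrable_diff dint gcont y)
      show "(\<lambda>t. C' * dist g h * exp (k * t)) integrable_on {0..y}"
        using exp_int by blast
      fix t assume "t \<in> {0..y}"
      have "norm (?f g t - ?f h t) \<le> C' * norm (exp (k * t) *\<^sub>R g t - exp (k * t) *\<^sub>R h t)"
        by (rule dlip)
      also have "\<dots> = C' * (exp (k * t) * dist (g t) (h t))"
        by (simp add: dist_norm flip: scaleR_diff_right)
      also have "\<dots> \<le> C' * (exp (k * t) * dist g h)"
        by (intro mult_left_mono dist_bounded) (use C' in auto)
      finally show "norm (?f g t - ?f h t) \<le> C' * dist g h * exp (k * t)"
        by (simp add: mult_ac)
    qed
    also have "\<dots> = C' * dist g h * exp (k * y) / k - C' * dist g h / k"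
      by (simp only: integral_unique[OF exp_int]) simp
    also have "\<dots> \<le> C' / k * dist g h * exp (k * y)" using C' k by simp
    also have "\<dots> \<le> 1 / 2 * dist g h * exp (k * y)"
      by (intro mult_right_mono) (use C' in \<open>auto simp: k_def field_simps\<close>)
    finally have *: "norm (integral {0..y} (?f g) - integral {0..y} (?f h)) \<le> 1 / 2 * dist g h * exp (k * y)"
      by (subst integral_diff[symmetric]) (auto intro!: dint gcont y)
    have "dist (T g x) (T h x)
        = exp (- k * y) * norm (integral {0..y} (?f g) - integral {0..y} (?f h))"
      unfolding T P_def y_def[symmetric] dist_norm by (simp flip: scaleR_diff_right)
    also have "\<dots> \<le> exp (- k * y) * (1 / 2 * dist g h * exp (k * y))"
      using * by (intro mult_left_mono) auto
    also have "\<dots> = 1 / 2 * dist g h" by (simp add: exp_minus)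
    finally show "dist (T g x) (T h x) \<le> 1 / 2 * dist g h" .
  qed
  then obtain g where g: "T g = g"
    using banach_fix_type[of "1/2" T] by auto
  define z where "z t = exp (k * t) *\<^sub>R apply_bcontfun g t" for t
  have zcont: "continuous_on {0..A} z" unfolding z_def by (rule gcont)
  have zeq: "z y = z0 + integral {0..y} (\<lambda>t. d t (z t))" if "y \<in> {0..A}" for y
  proof -
    have "g y = P (apply_bcontfun g) y" using T[of g y] that A by (simp add: g)
    then show ?thesis by (simp add: z_def P_def exp_minus)
  qed
  have zderiv: "(z has_vector_derivative c t (z t)) (at t)" if t: "t \<in> {0<..<A}" for t
  proof -
    have "continuous_on {0<..<A} (\<lambda>t. d t (z t))"
      using ccont[OF zcont]
      by (subst continuous_on_cong[OF refl, of _ _ "\<lambda>t. c t (z t)"]) (auto simp: d_def)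
    then have "continuous (at t) (\<lambda>t. d t (z t))"
      using t by (simp add: continuous_on_eq_continuous_at)
    then have "((\<lambda>y. integral {0..y} (\<lambda>t. d t (z t))) has_vector_derivative d t (z t)) (at t within ({0..A} - {}))"
      by (intro integral_has_vector_derivative_continuous_at[of _ 0 A t "{}"] dint zcont)
        (use t A in \<open>auto intro: continuous_at_imp_continuous_at_within\<close>)
    moreover have "at t within ({0..A} - {}) = at t"
      using t by (intro at_within_interior) (auto simp: interior_atLeastAtMost_real)
    ultimately have "((\<lambda>y. integral {0..y} (\<lambda>t. d t (z t))) has_vector_derivative c t (z t)) (at t)"
      using t by (simp add: d_def)
    from has_vector_derivative_add[OF has_vector_derivative_const this, of z0]
    have "((\<lambda>y. z0 + integral {0..y} (\<lambda>t. d t (z t))) has_vector_derivative c t (z t)) (at t)"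
      by simp
    then show ?thesis
    proof (rule has_vector_derivative_transform_within_open[OF _ open_greaterThanLessThan t])
      show "z0 + integral {0..y} (\<lambda>t. d t (z t)) = z y" if "y \<in> {0<..<A}" for y
        using zeq[of y] that by simp
    qed
  qed
  have "bounded (z ` {0..A})"
    using compact_continuous_image[OF zcont] compact_imp_bounded by blast
  then obtain N where N: "\<And>t. t \<in> {0..A} \<Longrightarrow> norm (z t) \<le> N"
    unfolding bounded_iff by blast
  have "norm (z y - z0) \<le> (M' + C' * N) * y" if y: "y \<in> {0..A}" for y
  proof -
    have "norm (integral {0..y} (\<lambda>t. d t (z t))) \<le> integral {0..y} (\<lambda>t. M' + C' * N)"
    proof (rule integral_norm_bound_integral[OF dint[OF zcont y]])
      fix t assume "t \<in> {0..y}"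
      then have "norm (z t) \<le> N" using N y by auto
      then show "norm (d t (z t)) \<le> M' + C' * N"
        using dgrow[of t "z t"] C' by (smt (verit) mult_left_mono)
    qed auto
    then show ?thesis using zeq[OF y] y by (simp add: mult.commute)
  qed
  with zcont zderiv show ?thesis by (rule that)
qed

section \<open>Uniqueness of the scattering solution\<close>

text \<open>Scattering conditions restrict the solution but not its derivative. Over a unit step,
  \<open>f' x\<close> differs from \<open>f (x + 1) - f x\<close> by at most the oscillation of
  \<open>f'\<close> there, which the smallness of \<open>f''\<close> controls.\<close>

lemma derivative_tendsto_zero_at_bot:
  fixes f f' f'' :: "real \<Rightarrow> 'a::real_normed_vector"
  assumes f': "\<And>x. (f has_vector_derivative f' x) (at x)"
    and f'': "\<And>x. (f' has_vector_derivative f'' x) (at x)"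
    and lim: "(f \<longlongrightarrow> 0) at_bot" and lim'': "(f'' \<longlongrightarrow> 0) at_bot"
  shows "(f' \<longlongrightarrow> 0) at_bot"
proof (rule tendstoI)
  fix e :: real assume e: "e > 0"
  then have "e / 4 > 0" by simp
  from tendstoD[OF lim this] tendstoD[OF lim'' this]
  have "\<forall>\<^sub>F x in at_bot. norm (f x) < e / 4 \<and> norm (f'' x) < e / 4"
    by eventually_elim simp
  then obtain N where N: "\<And>x. x \<le> N \<Longrightarrow> norm (f x) < e / 4 \<and> norm (f'' x) < e / 4"
    by (auto simp: eventually_at_bot_linorder)
  have "norm (f' x) < e" if x: "x \<le> N - 1" for x
  proof -
    have seg: "closed_segment x t = {x..t}" if "x \<le> t" for t
      using that by (simp add: closed_segment_eq_real_ivl)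
    have second: "norm (f' t - f' x) \<le> e / 4 * 1" if t: "t \<in> {x..x + 1}" for t
    proof -
      have "norm (f' t - f' x) \<le> e / 4 * norm (t - x)"
      proof (rule differentiable_bound[where S = "{x..x + 1}" and f' = "\<lambda>s h. h *\<^sub>R f'' s"])
        fix s assume s: "s \<in> {x..x + 1}"
        show "(f' has_derivative (\<lambda>h. h *\<^sub>R f'' s)) (at s within {x..x + 1})"
          using f''[of s] by (auto simp: has_vector_derivative_def intro: has_derivative_at_withinI)
        show "onorm (\<lambda>h. h *\<^sub>R f'' s) \<le> e / 4"
          using N[of s] s x by (simp add: onorm_scaleR_left onorm_id)
      qed (use t in auto)
      also have "\<dots> \<le> e / 4 * 1"
        using t e by (intro mult_left_mono) auto
      finally show ?thesis .
    qed
    have "norm (f (x + 1) - f x - (x + 1 - x) *\<^sub>R f' x) \<le> norm (x + 1 - x) * (e / 4 * 1)"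
      by (rule vector_differentiable_bound_linearization[where S = "{x..x + 1}"])
        (use second seg in \<open>auto intro: has_vector_derivative_at_within[OF f']\<close>)
    then have "norm (f (x + 1) - f x - f' x) \<le> e / 4" by simp
    moreover have "norm (f (x + 1)) < e / 4" "norm (f x) < e / 4" using N x by auto
    moreover have "norm (f' x) \<le> norm (f (x + 1) - f x - f' x) + norm (f (x + 1)) + norm (f x)"
      by (smt (verit) norm_minus_commute norm_triangle_sub norm_triangle_ineq4)
    ultimately show ?thesis using e by simp
  qed
  then show "\<forall>\<^sub>F x in at_bot. dist (f' x) 0 < e"
    by (auto simp: eventually_at_bot_linorder intro!: exI[of _ "N - 1"])
qed

lemma has_real_derivative_inner:
  fixes f g :: "real \<Rightarrow> 'a::real_inner"
  assumes "(f has_vector_derivative f') (at x)" and "(g has_vector_derivative g') (at x)"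
  shows "((\<lambda>x. f x \<bullet> g x) has_real_derivative (f x \<bullet> g' + f' \<bullet> g x)) (at x)"
  using bounded_bilinear.has_vector_derivative[OF bounded_bilinear_inner assms]
  by (simp add: has_real_derivative_iff_has_vector_derivative)

text \<open>A Gronwall argument started at -infinity: the energy \<open>E\<close> obeys
  \<open>E' \<le> U * E / \<omega>\<close>, so \<open>exp (- W / \<omega>) * E\<close> is
  nonincreasing, nonnegative and tends to 0 at -infinity. The finite limit of the antiderivative
  \<open>W\<close> expresses integrability of \<open>U\<close> there.\<close>

lemma schroedinger_solution_eq_zero:
  assumes \<omega>: "\<omega> > 0"
    and \<phi>: "schroedinger_solution \<omega> U \<phi>" and lim: "(\<phi> \<longlongrightarrow> 0) at_bot"
    and U: "\<And>x. U x \<ge> 0" "(U \<longlongrightarrow> 0) at_bot"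
    and W: "\<And>x. (W has_real_derivative U x) (at x)" "(W \<longlongrightarrow> w) at_bot"
  shows "\<phi> x = 0"
proof -
  obtain \<phi>' \<phi>'' where \<phi>': "\<And>x. (\<phi> has_vector_derivative \<phi>' x) (at x)"
    and \<phi>'': "\<And>x. (\<phi>' has_vector_derivative \<phi>'' x) (at x)"
    and eq: "\<And>x. \<phi>'' x + of_real (\<omega> ^ 2 - U x) * \<phi> x = 0"
    using \<phi> unfolding schroedinger_solution_def by blast
  have eq': "\<phi>'' x = (U x - \<omega> ^ 2) *\<^sub>R \<phi> x" for x
    using eq[of x] by (simp add: scaleR_conv_of_real algebra_simps eq_neg_iff_add_eq_0)
  have "((\<lambda>x. (U x - \<omega> ^ 2) *\<^sub>R \<phi> x) \<longlongrightarrow> (0 - \<omega> ^ 2) *\<^sub>R 0) at_bot"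
    by (intro tendsto_intros lim U)
  then have lim'': "(\<phi>'' \<longlongrightarrow> 0) at_bot" by (simp add: eq'[abs_def])
  note lim' = derivative_tendsto_zero_at_bot[OF \<phi>' \<phi>'' lim lim'']
  define E where "E x = \<omega> ^ 2 * (\<phi> x \<bullet> \<phi> x) + \<phi>' x \<bullet> \<phi>' x" for x
  have E': "(E has_real_derivative 2 * U x * (\<phi> x \<bullet> \<phi>' x)) (at x)" for x
    unfolding E_def
    by (rule derivative_eq_intros has_real_derivative_inner \<phi>' \<phi>'' refl)+
      (simp add: eq' inner_commute[of "\<phi>' x" "\<phi> x"] algebra_simps)
  have cross: "2 * (\<phi> x \<bullet> \<phi>' x) \<le> E x / \<omega>" for x
  proof -
    have "0 \<le> (\<omega> *\<^sub>R \<phi> x - \<phi>' x) \<bullet> (\<omega> *\<^sub>R \<phi> x - \<phi>' x)" by simp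
    also have "\<dots> = E x - 2 * \<omega> * (\<phi> x \<bullet> \<phi>' x)"
      by (simp add: E_def inner_diff inner_commute[of "\<phi>' x" "\<phi> x"] power2_eq_square algebra_simps)
    finally show ?thesis using \<omega> by (simp add: field_simps)
  qed
  define G where "G x = exp (- W x / \<omega>) * E x" for x
  have G': "(G has_real_derivative exp (- W x / \<omega>) * (2 * U x * (\<phi> x \<bullet> \<phi>' x) - U x * (E x / \<omega>))) (at x)" for x
    unfolding G_def
    by (rule DERIV_cong[OF DERIV_mult[OF DERIV_fun_exp[OF DERIV_cdivide[OF DERIV_minus[OF W(1)]]] E']])
      (simp add: algebra_simps)
  have "G x \<le> G y" if "y \<le> x" for y
  proof (rule DERIV_nonpos_imp_nonincreasing[OF that])
    fix t
    have "2 * U t * (\<phi> t \<bullet> \<phi>' t) - U t * (E t / \<omega>) = U t * (2 * (\<phi> t \<bullet> \<phi>' t) - E t / \<omega>)"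
      by (simp add: algebra_simps)
    also have "\<dots> \<le> 0" using cross[of t] U(1)[of t] by (simp add: mult_nonneg_nonpos)
    finally show "\<exists>d. (G has_real_derivative d) (at t) \<and> d \<le> 0"
      using G'[of t] by (meson exp_ge_zero mult_nonneg_nonpos)
  qed
  then have "\<forall>\<^sub>F y in at_bot. G x \<le> G y"
    by (auto simp: eventually_at_bot_linorder)
  moreover have "(G \<longlongrightarrow> exp (- w / \<omega>) * (\<omega> ^ 2 * (0 \<bullet> (0 :: complex)) + 0 \<bullet> (0 :: complex))) at_bot"
    unfolding G_def E_def using \<omega> by (intro tendsto_intros lim lim' W) auto
  ultimately have "G x \<le> 0"
    using tendsto_lowerbound[of G _ at_bot "G x"] by simp
  then have "E x \<le> 0" by (simp add: G_def mult_le_0_iff)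
  moreover have "E x \<ge> \<omega> ^ 2 * (\<phi> x \<bullet> \<phi> x)" by (simp add: E_def)
  ultimately have "\<omega> ^ 2 * (\<phi> x \<bullet> \<phi> x) \<le> 0" by linarith
  then have "\<phi> x \<bullet> \<phi> x \<le> 0" using \<omega> by (simp add: mult_le_0_iff)
  then show ?thesis by (metis inner_eq_zero_iff inner_ge_zero order_antisym)
qed

text \<open>A shift by a quarter period multiplies the two waves by \<i> and -\<i>. Hence
  \<open>f x - \<i> * f (x + pi / (2 * \<omega>))\<close> cancels the \<open>b\<close> wave and
  doubles the \<open>a\<close> wave, whose modulus is constant.\<close>

lemma plane_wave_amplitude_eq_zero:
  fixes a b :: complex
  assumes \<omega>: "\<omega> > 0"
    and lim: "((\<lambda>x. a * exp (\<i> * of_real (\<omega> * x)) + b * exp (- \<i> * of_real (\<omega> * x))) \<longlongrightarrow> 0) at_top"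
  shows "a = 0"
proof -
  define f where "f x = a * exp (\<i> * of_real (\<omega> * x)) + b * exp (- \<i> * of_real (\<omega> * x))" for x
  have shift: "filterlim (\<lambda>x :: real. x + pi / (2 * \<omega>)) at_top at_top"
    by (rule filterlim_tendsto_add_at_top[OF tendsto_const[of "pi / (2 * \<omega>)"] filterlim_ident, 
          unfolded add.commute[of "pi / (2 * \<omega>)"]])
  have f: "(f \<longlongrightarrow> 0) at_top" using lim by (simp add: f_def[abs_def])
  have "((\<lambda>x. f x - \<i> * f (x + pi / (2 * \<omega>))) \<longlongrightarrow> 0 - \<i> * 0) at_top"
    by (intro tendsto_diff tendsto_mult_left f filterlim_compose[OF f shift])
  moreover have "f x - \<i> * f (x + pi / (2 * \<omega>)) = 2 * a * exp (\<i> * of_real (\<omega> * x))" for x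
  proof -
    have *: "\<i> * of_real (\<omega> * (x + pi / (2 * \<omega>))) = \<i> * of_real (\<omega> * x) + \<i> * of_real (pi / 2)"
      using \<omega> by (simp add: field_simps)
    have e: "exp (\<i> * of_real (\<omega> * (x + pi / (2 * \<omega>)))) = \<i> * exp (\<i> * of_real (\<omega> * x))"
      unfolding * exp_add by (subst cis_conv_exp[symmetric]) simp
    have "exp (- \<i> * of_real (\<omega> * (x + pi / (2 * \<omega>)))) = - \<i> * exp (- \<i> * of_real (\<omega> * x))"
      using e by (simp add: exp_minus)
    with e show ?thesis by (simp add: f_def algebra_simps)
  qed
  ultimately have "((\<lambda>x. norm (2 * a * exp (\<i> * of_real (\<omega> * x)))) \<longlongrightarrow> norm (0 :: complex)) at_top"
    by (intro tendsto_norm) simp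
  then have "((\<lambda>x :: real. 2 * norm a) \<longlongrightarrow> 0) at_top"
    by (simp add: norm_mult)
  then show ?thesis by (simp add: tendsto_const_iff)
qed

lemma schroedinger_solution_diff:
  assumes "schroedinger_solution \<omega> U \<psi>" and "schroedinger_solution \<omega> U \<eta>"
  shows "schroedinger_solution \<omega> U (\<lambda>x. \<psi> x - \<eta> x)"
proof -
  obtain \<psi>' \<psi>'' \<eta>' \<eta>'' where \<psi>: "\<And>x. (\<psi> has_vector_derivative \<psi>' x) (at x)"
      "\<And>x. (\<psi>' has_vector_derivative \<psi>'' x) (at x)"
      "\<And>x. \<psi>'' x + of_real (\<omega> ^ 2 - U x) * \<psi> x = 0"
    and \<eta>: "\<And>x. (\<eta> has_vector_derivative \<eta>' x) (at x)"
      "\<And>x. (\<eta>' has_vector_derivative \<eta>'' x) (at x)"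
      "\<And>x. \<eta>'' x + of_real (\<omega> ^ 2 - U x) * \<eta> x = 0"
    using assms unfolding schroedinger_solution_def by metis
  have "\<psi>'' x - \<eta>'' x + of_real (\<omega> ^ 2 - U x) * (\<psi> x - \<eta> x) = 0" for x
    by (simp only: right_diff_distrib add_diff_add[symmetric] \<psi>(3) \<eta>(3) diff_self)
  with has_vector_derivative_diff[OF \<psi>(1) \<eta>(1)] has_vector_derivative_diff[OF \<psi>(2) \<eta>(2)]
  show ?thesis unfolding schroedinger_solution_def
    by (intro exI[of _ "\<lambda>x. \<psi>' x - \<eta>' x"] exI[of _ "\<lambda>x. \<psi>'' x - \<eta>'' x"] allI conjI)
qed

text \<open>The definite description needs uniqueness. Two scattering solutions differ by a solution
  that vanishes at -infinity, hence everywhere, and equal solutions have equal amplitudes at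
  +infinity.\<close>

lemma transmission_probability_eq:
  assumes \<omega>: "\<omega> > 0"
    and sol: "scattering_solution \<omega> U \<psi> \<alpha> \<beta>"
    and U: "\<And>x. U x \<ge> 0" "(U \<longlongrightarrow> 0) at_bot"
    and W: "\<And>x. (W has_real_derivative U x) (at x)" "(W \<longlongrightarrow> w) at_bot"
  shows "transmission_probability \<omega> U = 1 / (cmod \<alpha>) ^ 2"
proof -
  have "\<gamma> = \<alpha>" if sol': "scattering_solution \<omega> U \<eta> \<gamma> \<delta>" for \<eta> \<gamma> \<delta>
  proof -
    have lim: "((\<lambda>x. \<psi> x - exp (\<i> * of_real (\<omega> * x))) \<longlongrightarrow> 0) at_bot"
      "((\<lambda>x. \<eta> x - exp (\<i> * of_real (\<omega> * x))) \<longlongrightarrow> 0) at_bot"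
      "((\<lambda>x. \<psi> x - (\<alpha> * exp (\<i> * of_real (\<omega> * x)) + \<beta> * exp (- \<i> * of_real (\<omega> * x)))) \<longlongrightarrow> 0) at_top"
      "((\<lambda>x. \<eta> x - (\<gamma> * exp (\<i> * of_real (\<omega> * x)) + \<delta> * exp (- \<i> * of_real (\<omega> * x)))) \<longlongrightarrow> 0) at_top"
      using sol sol' unfolding scattering_solution_def by blast+
    have diff: "schroedinger_solution \<omega> U (\<lambda>x. \<eta> x - \<psi> x)"
      using sol sol' unfolding scattering_solution_def by (intro schroedinger_solution_diff) auto
    have "((\<lambda>x. \<eta> x - \<psi> x) \<longlongrightarrow> 0) at_bot"
      using tendsto_diff[OF lim(2,1)] by simp
    from schroedinger_solution_eq_zero[OF \<omega> diff this U W]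
    have eq: "\<eta> x = \<psi> x" for x by simp
    have "((\<lambda>x. (\<gamma> - \<alpha>) * exp (\<i> * of_real (\<omega> * x)) + (\<delta> - \<beta>) * exp (- \<i> * of_real (\<omega> * x))) \<longlongrightarrow> 0) at_top"
      by (rule Lim_transform_eventually[OF tendsto_diff[OF lim(3,4), unfolded diff_self]])
        (intro always_eventually allI, simp only: eq, simp only: left_diff_distrib, simp)
    from plane_wave_amplitude_eq_zero[OF \<omega> this] show ?thesis by simp
  qed
  then show ?thesis
    unfolding transmission_probability_def using sol by (intro the_equality) blast+
qed

section \<open>Energy bounds for a single barrier\<close>

text \<open>The arithmetic-geometric mean inequality combined with the flux inequality, in squared
  form to avoid roots of \<open>p\<close> and \<open>q\<close>.\<close>

lemma two_le_scaled_sum: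
  fixes p q \<omega> k :: real
  assumes "p \<ge> 0" "q \<ge> 0" "k > 0" "\<omega> ^ 2 \<le> p * q"
  shows "2 * \<omega> ^ 2 * k \<le> p * (\<omega> * k) ^ 2 + q" 
proof -
  have "(2 * \<omega> ^ 2 * k) ^ 2 = 4 * (\<omega> * k) ^ 2 * \<omega> ^ 2" by (simp add: power2_eq_square)
  also have "\<dots> \<le> 4 * (\<omega> * k) ^ 2 * (p * q)"
    using assms by (intro mult_left_mono) auto
  also have "\<dots> \<le> (p * (\<omega> * k) ^ 2 + q) ^ 2"
    using zero_le_power2[of "p * (\<omega> * k) ^ 2 - q"] by (simp add: power2_eq_square algebra_simps)
  finally show ?thesis
    by (rule power2_le_imp_le) (use assms in auto)
qed

text \<open>
  \<open>p\<close>, \<open>q\<close> and \<open>c\<close> stand for \<open>|\<psi>'|\<^sup>2\<close>, \<open>|\<psi>|\<^sup>2\<close> and \<open>Re (cnj \<psi> * \<psi>')\<close>; the inequality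
  \<open>\<omega>\<^sup>2 \<le> p * q\<close> is what remains of flux conservation.
\<close>

locale barrier_scattering =
  fixes \<omega> x0 :: real and U U' p q c :: "real \<Rightarrow> real"
  assumes \<omega>: "\<omega> > 0"
    and U': "\<And>x. (U has_real_derivative U' x) (at x)"
    and increasing: "\<And>x. x \<le> x0 \<Longrightarrow> U' x \<ge> 0"
    and decreasing: "\<And>x. x \<ge> x0 \<Longrightarrow> U' x \<le> 0"
    and U_pos: "\<And>x. U x > 0" and peak: "U x0 < \<omega> ^ 2"
    and q': "\<And>x. (q has_real_derivative 2 * c x) (at x)"
    and p': "\<And>x. (p has_real_derivative - 2 * (\<omega> ^ 2 - U x) * c x) (at x)"
    and nonneg: "\<And>x. p x \<ge> 0" "\<And>x. q x \<ge> 0"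
    and flux: "\<And>x. \<omega> ^ 2 \<le> p x * q x"
    and q_lim: "(q \<longlongrightarrow> 1) at_bot"
    and excess_lim: "((\<lambda>x. (p x + \<omega> ^ 2 * q x - 2 * \<omega> ^ 2) / U x) \<longlongrightarrow> 0) at_bot"
begin

text \<open>The right-hand side is the value of the left at \<open>p = \<omega>^2\<close>,
  \<open>q = 1\<close>, the data of a pure plane wave, as if the potential jumped from zero to its
  peak.\<close>

lemma energy_bound_left: "p x0 + (\<omega> ^ 2 - U x0) * q x0 \<le> \<omega> ^ 2 + (\<omega> ^ 2 - U x0)"
proof -
  \<comment> \<open>\<open>D / U\<close> is nonincreasing: \<open>D' = U' * (1 - q)\<close>, while the flux inequality gives \<open>(1 - q) * U \<le> D\<close>.\<close>
  define D where "D x = p x + (\<omega> ^ 2 - U x) * q x - \<omega> ^ 2 - (\<omega> ^ 2 - U x)" for x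
  have D': "(D has_real_derivative U' x * (1 - q x)) (at x)" for x
    unfolding D_def by (rule derivative_eq_intros p' q' U' refl)+ (simp add: algebra_simps)
  have D_ge: "(1 - q x) * U x \<le> D x" for x
    using two_le_scaled_sum[of "q x" "p x" 1 \<omega>] nonneg[of x] flux[of x]
    by (simp add: D_def algebra_simps)
  have "D x0 / U x0 \<le> D y / U y" if "y \<le> x0" for y
  proof (rule DERIV_nonpos_imp_nonincreasing[OF that])
    fix x assume "x \<le> x0"
    then have "U' x * ((1 - q x) * U x) \<le> U' x * D x"
      by (intro mult_left_mono D_ge increasing)
    then have "(U' x * (1 - q x) * U x - D x * U' x) / (U x * U x) \<le> 0"
      by (intro divide_nonpos_nonneg) (auto simp: mult_ac)
    moreover have "((\<lambda>x. D x / U x) has_real_derivative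
        (U' x * (1 - q x) * U x - D x * U' x) / (U x * U x)) (at x)"
      using U_pos[of x] by (intro DERIV_divide D' U') auto
    ultimately show "\<exists>d. ((\<lambda>x. D x / U x) has_real_derivative d) (at x) \<and> d \<le> 0" by blast
  qed
  then have "\<forall>\<^sub>F y in at_bot. D x0 / U x0 \<le> D y / U y"
    by (auto simp: eventually_at_bot_linorder)
  moreover have "((\<lambda>x. D x / U x) \<longlongrightarrow> 0) at_bot"
  proof -
    \<comment> \<open>If \<open>U\<close> vanishes at -infinity this quotient is of the form 0/0;
      the limit exists because the excess energy is of smaller order than \<open>U\<close>.\<close>
    have eq: "D x / U x = (p x + \<omega> ^ 2 * q x - 2 * \<omega> ^ 2) / U x + (1 - q x)" for x
      using U_pos[of x] by (simp add: D_def field_simps)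
    have "((\<lambda>x. D x / U x) \<longlongrightarrow> 0 + (1 - 1)) at_bot"
      unfolding eq by (intro tendsto_intros excess_lim q_lim)
    then show ?thesis by simp
  qed
  ultimately have "D x0 / U x0 \<le> 0"
    using tendsto_lowerbound[of "\<lambda>x. D x / U x" 0 at_bot "D x0 / U x0"] by simp
  then show ?thesis using U_pos[of x0] by (simp add: D_def divide_le_0_iff)
qed

text \<open>With \<open>K = \<omega>^2 - U x0\<close>, the right-hand side is the value of the left
  at \<open>p = K\<close>, \<open>q = \<omega>^2 / K\<close>. These data have the same
  \<open>p + K * q\<close> as the plane wave data \<open>p = \<omega>^2\<close>,
  \<open>q = 1\<close>: a square barrier of the peak height exchanges the two pairs when its width
  is a quarter wavelength, its most reflecting width.\<close>

lemma energy_bound_right: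
  assumes x: "x \<ge> x0"
  shows "p x + (\<omega> ^ 2 - U x) * q x \<le> \<omega> ^ 2 * (\<omega> ^ 2 - U x) / (\<omega> ^ 2 - U x0) + (\<omega> ^ 2 - U x0)"
proof -
  define K where "K = \<omega> ^ 2 - U x0"
  define H where "H x = \<omega> ^ 2 - U x" for x
  have K: "0 < K" "K < \<omega> ^ 2" using peak U_pos[of x0] by (auto simp: K_def)
  have HK: "K \<le> H x" if "x0 \<le> x" for x
  proof -
    have "U x \<le> U x0"
      using U' decreasing by (intro DERIV_nonpos_imp_nonincreasing[OF that]) blast
    then show ?thesis by (simp add: H_def K_def)
  qed
  have H': "(H has_real_derivative - U' x) (at x)" for x
    unfolding H_def by (rule derivative_eq_intros U' refl)+ simp
  \<comment> \<open>\<open>D / S\<close> is nonincreasing: \<open>D' = S' * (K - p)\<close>, while the flux inequality gives \<open>(K - p) * S \<le> D\<close>.\<close>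
  define D where "D x = p x / H x + q x - \<omega> ^ 2 / K - K / H x" for x
  define S where "S x = \<omega> ^ 2 / K ^ 2 - 1 / H x" for x
  have S_pos: "S x > 0" if "x0 \<le> x" for x
  proof -
    have "K * K < \<omega> ^ 2 * H x"
      using HK[OF that] K by (intro mult_less_le_imp_less) auto
    then show ?thesis using HK[OF that] K by (simp add: S_def field_simps power2_eq_square)
  qed
  have D': "(D has_real_derivative - U' x / (H x) ^ 2 * (K - p x)) (at x)" if "x0 \<le> x" for x
  proof -
    have H: "H x \<noteq> 0" using HK[OF that] K by auto
    have "(p has_real_derivative - 2 * H x * c x) (at x)" using p'[of x] by (simp add: H_def)
    then have "(D has_real_derivative ((- 2 * H x * c x) * H x - p x * (- U' x)) / (H x * H x)
        + 2 * c x - 0 - (0 * H x - K * (- U' x)) / (H x * H x)) (at x)"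
      unfolding D_def
      by (intro DERIV_add DERIV_diff DERIV_divide DERIV_const q' H' H)
    moreover have "((- 2 * H x * c x) * H x - p x * (- U' x)) / (H x * H x)
        + 2 * c x - 0 - (0 * H x - K * (- U' x)) / (H x * H x) = - U' x / (H x) ^ 2 * (K - p x)"
      using H by (simp add: divide_simps power2_eq_square) algebra
    ultimately show ?thesis by simp
  qed
  have S': "(S has_real_derivative - U' x / (H x) ^ 2) (at x)" if "x0 \<le> x" for x
  proof -
    have H: "H x \<noteq> 0" using HK[OF that] K by auto
    have "(S has_real_derivative 0 - (0 * H x - 1 * (- U' x)) / (H x * H x)) (at x)"
      unfolding S_def by (intro DERIV_diff DERIV_divide DERIV_const H' H)
    then show ?thesis by (simp add: power2_eq_square)
  qed
  have D_ge: "(K - p x) * S x \<le> D x" if "x0 \<le> x" for x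
  proof -
    define a b where "a = 1 / K" and "b = 1 / H x"
    have a: "K * a = 1" using K by (simp add: a_def)
    have "D x - (K - p x) * S x = (p x * b + q x - \<omega> ^ 2 * a - K * b) - (K - p x) * (\<omega> ^ 2 * a ^ 2 - b)"
      by (simp add: D_def S_def a_def b_def power_divide)
    also have "\<dots> = p x * (\<omega> * a) ^ 2 + q x - 2 * \<omega> ^ 2 * a - \<omega> ^ 2 * a * (K * a - 1)"
      by (simp add: algebra_simps power2_eq_square)
    finally have "D x - (K - p x) * S x = p x * (\<omega> * (1 / K)) ^ 2 + q x - 2 * \<omega> ^ 2 * (1 / K)"
      by (simp add: a) (simp add: a_def)
    then show ?thesis
      using two_le_scaled_sum[of "p x" "q x" "1 / K" \<omega>] nonneg[of x] flux[of x] K by simp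
  qed
  have "D x / S x \<le> D x0 / S x0"
  proof (rule DERIV_nonpos_imp_nonincreasing[OF x])
    fix t assume t: "x0 \<le> t"
    let ?h = "- U' t / (H t) ^ 2"
    have "?h * ((K - p t) * S t) \<le> ?h * D t"
      using decreasing[OF t] by (intro mult_left_mono D_ge t) (simp add: divide_nonpos_nonneg)
    then have "?h * (K - p t) * S t - D t * ?h \<le> 0"
      by (simp only: mult.assoc mult.commute[of "D t"] diff_le_0_iff_le)
    then have "(?h * (K - p t) * S t - D t * ?h) / (S t * S t) \<le> 0"
      by (rule divide_nonpos_nonneg) simp
    with DERIV_divide[OF D'[OF t] S'[OF t]] S_pos[OF t]
    show "\<exists>d. ((\<lambda>x. D x / S x) has_real_derivative d) (at t) \<and> d \<le> 0"
      by (metis less_irrefl)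
  qed
  also have "D x0 / S x0 \<le> 0"
  proof -
    have "D x0 = p x0 / K + q x0 - \<omega> ^ 2 / K - K / K" by (simp add: D_def H_def K_def)
    then have "K * D x0 = p x0 + K * q x0 - \<omega> ^ 2 - K"
      using K by (simp add: right_diff_distrib distrib_left)
    then have "K * D x0 \<le> 0" using energy_bound_left unfolding K_def by linarith
    then have "D x0 \<le> 0" using K by (simp add: mult_le_0_iff)
    then show ?thesis using S_pos[of x0] by (simp add: divide_le_0_iff)
  qed
  finally have "D x \<le> 0" using S_pos[OF x] by (simp add: divide_le_0_iff)
  then have "H x * D x \<le> 0" using HK[OF x] K by (simp add: mult_le_0_iff)
  moreover have "H x * D x = p x + H x * q x - \<omega> ^ 2 * H x / K - K"
    using HK[OF x] K by (simp add: D_def right_diff_distrib distrib_left)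
  ultimately have "p x + H x * q x \<le> \<omega> ^ 2 * H x / K + K" by linarith
  then show ?thesis by (simp only: H_def K_def)
qed

end

section \<open>Scattering by a single barrier\<close>

lemma plane_wave_inverse:
  "exp (\<i> * complex_of_real y) * exp (- \<i> * complex_of_real y) = 1"
  by (simp flip: exp_add)

lemma norm_plane_wave [simp]:
  "cmod (exp (\<i> * complex_of_real y)) = 1" "cmod (exp (- \<i> * complex_of_real y)) = 1"
  by (simp_all add: norm_exp_eq_Re)

text \<open>
  The bounded variable \<open>Y\<close> with \<open>Y' * P = U\<close> turns the equation on the whole line into one with
  bounded coefficients on \<open>(0, A)\<close>, so the amplitudes at \<open>-\<infinity>\<close> and \<open>+\<infinity>\<close> are the values of its solution
  at the end points.
\<close>

lemma plane_wave_amplitudes_exist: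
  fixes \<omega> A N :: real and X Y Y' P U :: "real \<Rightarrow> real"
  assumes \<omega>: "\<omega> > 0"
    and X: "continuous_on {0<..<A} X" and P: "continuous_on {0<..<A} P"
    and P_bound: "\<And>y. y \<in> {0<..<A} \<Longrightarrow> \<bar>P y\<bar> \<le> N"
    and Y: "\<And>x. Y x \<in> {0<..<A}" "\<And>x. X (Y x) = x"
    and Y': "\<And>x. (Y has_real_derivative Y' x) (at x)"
    and Y_lim: "(Y \<longlongrightarrow> 0) at_bot" "(Y \<longlongrightarrow> A) at_top"
    and U: "\<And>x. U x = Y' x * P (Y x)"
  obtains a b :: "real \<Rightarrow> complex" and \<alpha> \<beta> :: complex and B :: real
  where "\<And>x. (a has_vector_derivative of_real (U x) / (2 * \<i> * of_real \<omega>) *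
          (a x + b x * exp (- \<i> * of_real (\<omega> * x)) ^ 2)) (at x)"
    and "\<And>x. (b has_vector_derivative - (of_real (U x) / (2 * \<i> * of_real \<omega>) *
          (a x * exp (\<i> * of_real (\<omega> * x)) ^ 2 + b x))) (at x)"
    and "(a \<longlongrightarrow> 1) at_bot" "(b \<longlongrightarrow> 0) at_bot"
    and "(a \<longlongrightarrow> \<alpha>) at_top" "(b \<longlongrightarrow> \<beta>) at_top"
    and "\<And>x. cmod (b x) \<le> B * Y x"
proof -
  define k where "k y = complex_of_real (P y) / (2 * \<i> * of_real \<omega>)" for y
  define e f where "e y = exp (\<i> * complex_of_real (\<omega> * X y))"
    and "f y = exp (- \<i> * complex_of_real (\<omega> * X y))" for y
  \<comment> \<open>The amplitude system with \<open>Y\<close> as independent variable: division by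
    \<open>Y'\<close> leaves \<open>P\<close> in place of \<open>U\<close>. The phases need not
    converge at the ends, but have modulus 1, so the coefficients stay bounded.\<close>
  define c :: "real \<Rightarrow> complex \<times> complex \<Rightarrow> complex \<times> complex"
    where "c y v = (k y * (fst v + snd v * f y ^ 2), - (k y * (fst v * e y ^ 2 + snd v)))" for y v
  have A: "A > 0" using Y(1)[of 0] by auto
  have norm1: "cmod (e y) = 1" "cmod (f y) = 1" for y
    unfolding e_def f_def by (rule norm_plane_wave)+
  have k: "cmod (k y) \<le> N / (2 * \<omega>)" if "y \<in> {0<..<A}" for y
    using P_bound[OF that] \<omega> by (simp add: k_def norm_divide norm_mult divide_right_mono)
  have "continuous_on ({0<..<A} \<times> UNIV) (\<lambda>(t, v). c t v)"
  proof -
    have fst: "continuous_on ({0<..<A} \<times> (UNIV :: (complex \<times> complex) set)) (\<lambda>z. g (fst z))"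
      if "continuous_on {0<..<A} g" for g :: "real \<Rightarrow> real"
      by (rule continuous_on_compose2[OF that]) (auto intro!: continuous_intros)
    show ?thesis
      unfolding c_def k_def e_def f_def split_def
      using \<omega> by (auto intro!: continuous_intros fst X P)
  qed
  moreover have "norm (c t v - c t w) \<le> 2 * N / \<omega> * norm (v - w)" if t: "t \<in> {0<..<A}" for t v w
  proof -
    define u where "u = v - w"
    have "c t v - c t w = (k t * (fst u + snd u * f t ^ 2), - (k t * (fst u * e t ^ 2 + snd u)))"
      by (simp add: c_def u_def algebra_simps)
    also have "norm \<dots> \<le> cmod (k t * (fst u + snd u * f t ^ 2)) + cmod (k t * (fst u * e t ^ 2 + snd u))"
      using norm_Pair_le[of "k t * (fst u + snd u * f t ^ 2)" "- (k t * (fst u * e t ^ 2 + snd u))"]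
      by (simp only: norm_minus_cancel)
    also have "\<dots> = cmod (k t) * (cmod (fst u + snd u * f t ^ 2) + cmod (fst u * e t ^ 2 + snd u))"
      unfolding norm_mult by (rule distrib_left[symmetric])
    also have "\<dots> \<le> cmod (k t) * (4 * norm u)"
    proof (intro mult_left_mono)
      have "cmod (fst u + snd u * f t ^ 2) \<le> cmod (fst u) + cmod (snd u)"
        using norm_triangle_ineq[of "fst u" "snd u * f t ^ 2"] by (simp add: norm_mult norm_power norm1)
      moreover have "cmod (fst u * e t ^ 2 + snd u) \<le> cmod (fst u) + cmod (snd u)"
        using norm_triangle_ineq[of "fst u * e t ^ 2" "snd u"] by (simp add: norm_mult norm_power norm1)
      moreover have "cmod (fst u) \<le> norm u" "cmod (snd u) \<le> norm u"
        using norm_fst_le[of "fst u" "snd u"] norm_snd_le[of "snd u" "fst u"] by simp_all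
      ultimately show "cmod (fst u + snd u * f t ^ 2) + cmod (fst u * e t ^ 2 + snd u) \<le> 4 * norm u"
        by linarith
    qed auto
    also have "\<dots> \<le> N / (2 * \<omega>) * (4 * norm u)"
      by (intro mult_right_mono k t) auto
    finally show ?thesis by (simp add: u_def)
  qed
  moreover have "norm (c t 0) \<le> 0" for t by (simp add: c_def zero_prod_def)
  ultimately obtain z B where z: "continuous_on {0..A} z"
    "\<And>t. t \<in> {0<..<A} \<Longrightarrow> (z has_vector_derivative c t (z t)) (at t)"
    "\<And>t. t \<in> {0..A} \<Longrightarrow> norm (z t - (1, 0)) \<le> B * t"
    using lipschitz_ode_solution_exists[OF A, of c "2 * N / \<omega>" 0 "(1, 0)"] by blast
  have zY: "((\<lambda>x. z (Y x)) has_vector_derivative Y' x *\<^sub>R c (Y x) (z (Y x))) (at x)" for x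
    using vector_diff_chain_at[of Y "Y' x" x z, OF _ z(2)[OF Y(1)]] Y'[of x]
    by (simp add: has_real_derivative_iff_has_vector_derivative o_def)
  have lim: "((\<lambda>x. z (Y x)) \<longlongrightarrow> z l) F"
    if "(Y \<longlongrightarrow> l) F" "l \<in> {0..A}" for l F
    using Y(1) by (intro continuous_on_tendsto_compose[OF z(1) that]) (auto intro!: always_eventually less_imp_le)
  have z0: "z 0 = (1, 0)" using z(3)[of 0] A by simp
  show ?thesis
  proof
    show "((\<lambda>x. fst (z (Y x))) has_vector_derivative of_real (U x) / (2 * \<i> * of_real \<omega>) *
          (fst (z (Y x)) + snd (z (Y x)) * exp (- \<i> * of_real (\<omega> * x)) ^ 2)) (at x)" for x
      using bounded_linear.has_vector_derivative[OF bounded_linear_fst zY[of x]]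
      by (simp add: c_def U k_def f_def Y scaleR_conv_of_real mult.assoc)
    show "((\<lambda>x. snd (z (Y x))) has_vector_derivative - (of_real (U x) / (2 * \<i> * of_real \<omega>) *
          (fst (z (Y x)) * exp (\<i> * of_real (\<omega> * x)) ^ 2 + snd (z (Y x))))) (at x)" for x
      using bounded_linear.has_vector_derivative[OF bounded_linear_snd zY[of x]]
      by (simp add: c_def U k_def e_def Y scaleR_conv_of_real mult.assoc)
    have z0_lim: "((\<lambda>x. z (Y x)) \<longlongrightarrow> (1, 0)) at_bot" using lim[OF Y_lim(1)] A by (simp add: z0)
    show "((\<lambda>x. fst (z (Y x))) \<longlongrightarrow> 1) at_bot" "((\<lambda>x. snd (z (Y x))) \<longlongrightarrow> 0) at_bot"
      using tendsto_fst[OF z0_lim] tendsto_snd[OF z0_lim] by simp_all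
    have zA_lim: "((\<lambda>x. z (Y x)) \<longlongrightarrow> z A) at_top" using lim[OF Y_lim(2)] A by simp
    show "((\<lambda>x. fst (z (Y x))) \<longlongrightarrow> fst (z A)) at_top" "((\<lambda>x. snd (z (Y x))) \<longlongrightarrow> snd (z A)) at_top"
      using tendsto_fst[OF zA_lim] tendsto_snd[OF zA_lim] by simp_all
    show "cmod (snd (z (Y x))) \<le> B * Y x" for x
    proof -
      have "cmod (snd (z (Y x) - (1, 0))) \<le> norm (z (Y x) - (1, 0))" by (metis norm_snd_le prod.collapse)
      also have "\<dots> \<le> B * Y x" using z(3)[of "Y x"] Y(1)[of x] by auto
      finally show ?thesis by simp
    qed
  qed
qed

lemma inner_i_times_self [simp]: "(\<i> * z) \<bullet> z = 0" for z :: complex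
  by (simp add: inner_complex_def)

text \<open>The hypotheses on \<open>Y\<close> and \<open>P\<close> give existence of the scattering
  solution, those on \<open>W\<close> its uniqueness. \<open>Y_U_lim\<close> makes the excess energy
  \<open>4 * \<omega>^2 * |b|^2\<close> negligible against \<open>U\<close> at -infinity, because
  \<open>|b|\<close> is at most a multiple of \<open>Y\<close>. The energy bound at +infinity,
  together with \<open>|\<alpha>|^2 = 1 + |\<beta>|^2\<close>, then bounds
  \<open>|\<alpha>|\<close>.\<close>

lemma transmission_probability_ge:
  fixes \<omega> A N x0 :: real and X Y Y' P U U' W :: "real \<Rightarrow> real"
  assumes \<omega>: "\<omega> > 0"
    and X: "continuous_on {0<..<A} X" and P: "continuous_on {0<..<A} P"
    and P_bound: "\<And>y. y \<in> {0<..<A} \<Longrightarrow> \<bar>P y\<bar> \<le> N"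
    and Y: "\<And>x. Y x \<in> {0<..<A}" "\<And>x. X (Y x) = x"
    and Y': "\<And>x. (Y has_real_derivative Y' x) (at x)"
    and Y_lim: "(Y \<longlongrightarrow> 0) at_bot" "(Y \<longlongrightarrow> A) at_top"
    and U: "\<And>x. U x = Y' x * P (Y x)"
    and U': "\<And>x. (U has_real_derivative U' x) (at x)"
    and increasing: "\<And>x. x \<le> x0 \<Longrightarrow> U' x \<ge> 0"
    and decreasing: "\<And>x. x \<ge> x0 \<Longrightarrow> U' x \<le> 0"
    and U_pos: "\<And>x. U x > 0" and peak: "U x0 < \<omega> ^ 2"
    and U_lim: "(U \<longlongrightarrow> 0) at_bot" "(U \<longlongrightarrow> 0) at_top"
    and Y_U_lim: "((\<lambda>x. (Y x) ^ 2 / U x) \<longlongrightarrow> 0) at_bot"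
    and W: "\<And>x. (W has_real_derivative U x) (at x)" "(W \<longlongrightarrow> w) at_bot"
  shows "transmission_probability \<omega> U \<ge> 4 * \<omega> ^ 2 * (\<omega> ^ 2 - U x0) / (2 * \<omega> ^ 2 - U x0) ^ 2"
proof -
  obtain a b \<alpha> \<beta> B where
    a': "\<And>x. (a has_vector_derivative of_real (U x) / (2 * \<i> * of_real \<omega>) *
          (a x + b x * exp (- \<i> * of_real (\<omega> * x)) ^ 2)) (at x)"
    and b': "\<And>x. (b has_vector_derivative - (of_real (U x) / (2 * \<i> * of_real \<omega>) *
          (a x * exp (\<i> * of_real (\<omega> * x)) ^ 2 + b x))) (at x)"
    and lim_bot: "(a \<longlongrightarrow> 1) at_bot" "(b \<longlongrightarrow> 0) at_bot"
    and lim_top: "(a \<longlongrightarrow> \<alpha>) at_top" "(b \<longlongrightarrow> \<beta>) at_top"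
    and b_le: "\<And>x. cmod (b x) \<le> B * Y x"
    using plane_wave_amplitudes_exist[OF \<omega> X P P_bound Y Y' Y_lim U] by metis
  define e f where "e x = exp (\<i> * complex_of_real (\<omega> * x))"
    and "f x = exp (- \<i> * complex_of_real (\<omega> * x))" for x
  have ef: "e x * f x = 1" for x unfolding e_def f_def by (rule plane_wave_inverse)
  have norm1: "cmod (e x) = 1" "cmod (f x) = 1" for x
    unfolding e_def f_def by (rule norm_plane_wave)+
  have e': "(e has_vector_derivative (\<i> * of_real \<omega> * e x)) (at x)" for x
    unfolding e_def
    by (rule has_vector_derivative_eq_rhs[OF field_vector_diff_chain_at[where g = exp, unfolded o_def]])
      (auto intro!: derivative_eq_intros)
  have f': "(f has_vector_derivative (- \<i> * of_real \<omega> * f x)) (at x)" for x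
    unfolding f_def
    by (rule has_vector_derivative_eq_rhs[OF field_vector_diff_chain_at[where g = exp, unfolded o_def]])
      (auto intro!: derivative_eq_intros)
  define k where "k x = complex_of_real (U x) / (2 * \<i> * of_real \<omega>)" for x
  have k: "\<i> * of_real \<omega> * (2 * k x) = of_real (U x)" for x using \<omega> by (simp add: k_def)
  note a' = a'[folded e_def f_def k_def] and b' = b'[folded e_def f_def k_def]
  define \<psi> \<psi>' where "\<psi> x = a x * e x + b x * f x"
    and "\<psi>' x = \<i> * of_real \<omega> * (a x * e x - b x * f x)" for x
  have \<psi>': "(\<psi> has_vector_derivative \<psi>' x) (at x)" for x
  proof -
    have "(\<psi> has_vector_derivative (a x * (\<i> * of_real \<omega> * e x) + k x * (a x + b x * f x ^ 2) * e x)
        + (b x * (- \<i> * of_real \<omega> * f x) + - (k x * (a x * e x ^ 2 + b x)) * f x)) (at x)"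
      unfolding \<psi>_def by (intro has_vector_derivative_add has_vector_derivative_mult a' b' e' f')
    \<comment> \<open>The terms from \<open>a'\<close> and \<open>b'\<close> are collected into a
      multiple of \<open>e x * f x - 1\<close>, which is zero: this is the variation of constants
      condition.\<close>
    moreover have "(a x * (\<i> * of_real \<omega> * e x) + k x * (a x + b x * f x ^ 2) * e x)
        + (b x * (- \<i> * of_real \<omega> * f x) + - (k x * (a x * e x ^ 2 + b x)) * f x)
      = \<psi>' x + k x * (b x * f x - a x * e x) * (e x * f x - 1)"
      by (simp add: \<psi>'_def power2_eq_square algebra_simps)
    ultimately show ?thesis by (simp add: ef)
  qed
  have \<psi>'': "(\<psi>' has_vector_derivative (U x - \<omega> ^ 2) *\<^sub>R \<psi> x) (at x)" for x
  proof -
    have "(\<psi>' has_vector_derivative \<i> * of_real \<omega> * ((a x * (\<i> * of_real \<omega> * e x) + k x * (a x + b x * f x ^ 2) * e x)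
        - (b x * (- \<i> * of_real \<omega> * f x) + - (k x * (a x * e x ^ 2 + b x)) * f x))) (at x)"
      unfolding \<psi>'_def
      by (intro has_vector_derivative_mult_right has_vector_derivative_diff has_vector_derivative_mult a' b' e' f')
    moreover have "\<i> * of_real \<omega> * ((a x * (\<i> * of_real \<omega> * e x) + k x * (a x + b x * f x ^ 2) * e x)
        - (b x * (- \<i> * of_real \<omega> * f x) + - (k x * (a x * e x ^ 2 + b x)) * f x))
      = \<i> * of_real \<omega> * (2 * k x) * \<psi> x - of_real \<omega> ^ 2 * \<psi> x
        + \<i> * of_real \<omega> * k x * (a x * e x + b x * f x) * (e x * f x - 1)"
      by (simp add: \<psi>_def power2_eq_square algebra_simps)
    moreover have "\<dots> = (U x - \<omega> ^ 2) *\<^sub>R \<psi> x"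
      by (simp add: ef k scaleR_conv_of_real left_diff_distrib)
    ultimately show ?thesis by (simp only:)
  qed
  have lim_diff: "((\<lambda>x. \<psi> x - (A0 * e x + B0 * f x)) \<longlongrightarrow> 0) F"
    if "(a \<longlongrightarrow> A0) F" "(b \<longlongrightarrow> B0) F" for A0 B0 F
  proof (rule Lim_null_comparison)
    show "\<forall>\<^sub>F x in F. norm (\<psi> x - (A0 * e x + B0 * f x)) \<le> cmod (a x - A0) + cmod (b x - B0)"
    proof (intro always_eventually allI)
      fix x
      have "\<psi> x - (A0 * e x + B0 * f x) = (a x - A0) * e x + (b x - B0) * f x"
        by (simp add: \<psi>_def algebra_simps)
      then show "norm (\<psi> x - (A0 * e x + B0 * f x)) \<le> cmod (a x - A0) + cmod (b x - B0)"
        using norm_triangle_ineq[of "(a x - A0) * e x" "(b x - B0) * f x"]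
        by (simp add: norm_mult norm1)
    qed
    have "((\<lambda>x. cmod (a x - A0) + cmod (b x - B0)) \<longlongrightarrow> cmod (A0 - A0) + cmod (B0 - B0)) F"
      by (intro tendsto_intros that)
    then show "((\<lambda>x. cmod (a x - A0) + cmod (b x - B0)) \<longlongrightarrow> 0) F" by simp
  qed
  have "schroedinger_solution \<omega> U \<psi>"
    unfolding schroedinger_solution_def
    by (intro exI[of _ \<psi>'] exI[of _ "\<lambda>x. (U x - \<omega> ^ 2) *\<^sub>R \<psi> x"] allI conjI \<psi>' \<psi>'')
      (simp add: scaleR_conv_of_real algebra_simps)
  then have "scattering_solution \<omega> U \<psi> \<alpha> \<beta>"
    unfolding scattering_solution_def
    using lim_diff[OF lim_bot] lim_diff[OF lim_top] by (simp add: e_def f_def)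
  from transmission_probability_eq[OF \<omega> this less_imp_le[OF U_pos] U_lim(1) W]
  have T: "transmission_probability \<omega> U = 1 / (cmod \<alpha>) ^ 2" .
  define p q where "p x = \<psi>' x \<bullet> \<psi>' x" and "q x = \<psi> x \<bullet> \<psi> x" for x
  have energy: "p x + \<omega> ^ 2 * q x = 2 * \<omega> ^ 2 * (cmod (a x) ^ 2 + cmod (b x) ^ 2)" for x
  proof -
    define u v where "u = a x * e x" and "v = b x * f x"
    have "p x + \<omega> ^ 2 * q x = 2 * \<omega> ^ 2 * (cmod u ^ 2 + cmod v ^ 2)"
      unfolding p_def q_def \<psi>_def \<psi>'_def u_def[symmetric] v_def[symmetric] cmod_power2
      by (simp add: inner_complex_def power2_eq_square algebra_simps)
    then show ?thesis by (simp add: u_def v_def norm_mult norm1)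
  qed
  \<comment> \<open>\<open>J\<close> is the flux \<open>Im (cnj \<psi> * \<psi>')\<close>. It is
    constant because the potential is real, and its value is read off at -infinity.\<close>
  define J where "J x = (\<i> * \<psi> x) \<bullet> \<psi>' x" for x
  have J: "J x = \<omega> * (cmod (a x) ^ 2 - cmod (b x) ^ 2)" for x
  proof -
    define u v where "u = a x * e x" and "v = b x * f x"
    have "J x = \<omega> * (cmod u ^ 2 - cmod v ^ 2)"
      unfolding J_def \<psi>_def \<psi>'_def u_def[symmetric] v_def[symmetric] cmod_power2
      by (simp add: inner_complex_def power2_eq_square algebra_simps)
    then show ?thesis by (simp add: u_def v_def norm_mult norm1)
  qed
  have "(J has_real_derivative 0) (at x)" for x
  proof -
    have "(J has_real_derivative (\<i> * \<psi> x) \<bullet> ((U x - \<omega> ^ 2) *\<^sub>R \<psi> x) + (\<i> * \<psi>' x) \<bullet> \<psi>' x) (at x)"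
      unfolding J_def
      by (intro has_real_derivative_inner has_vector_derivative_mult_right \<psi>' \<psi>'')
    then show ?thesis by simp
  qed
  then have J_const: "J x = J y" for x y by (intro DERIV_isconst_all) auto
  have "((\<lambda>x. \<omega> * (cmod (a x) ^ 2 - cmod (b x) ^ 2)) \<longlongrightarrow> \<omega> * (cmod 1 ^ 2 - cmod 0 ^ 2)) at_bot"
    by (intro tendsto_intros lim_bot)
  then have "(J \<longlongrightarrow> \<omega>) at_bot" by (simp add: J[abs_def])
  moreover have "J = (\<lambda>_. J 0)" using J_const by auto
  ultimately have J_eq: "J x = \<omega>" for x
    using J_const[of x 0] tendsto_unique[of at_bot J \<omega> "J 0"] by (metis tendsto_const trivial_limit_at_bot_linorder)
  have unit: "cmod (a x) ^ 2 = 1 + cmod (b x) ^ 2" for x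
    using J[of x] J_eq[of x] \<omega> by simp
  interpret barrier_scattering \<omega> x0 U U' p q "\<lambda>x. \<psi> x \<bullet> \<psi>' x"
  proof
    show "(q has_real_derivative 2 * (\<psi> x \<bullet> \<psi>' x)) (at x)" for x
      unfolding q_def using has_real_derivative_inner[OF \<psi>' \<psi>', of x]
      by (simp add: inner_commute)
    show "(p has_real_derivative - 2 * (\<omega> ^ 2 - U x) * (\<psi> x \<bullet> \<psi>' x)) (at x)" for x
      unfolding p_def using has_real_derivative_inner[OF \<psi>'' \<psi>'', of x]
      by (rule DERIV_cong) (simp add: inner_commute algebra_simps)
    show "p x \<ge> 0" "q x \<ge> 0" for x by (auto simp: p_def q_def)
    show "\<omega> ^ 2 \<le> p x * q x" for x
    proof -
      have "\<omega> ^ 2 \<le> ((\<i> * \<psi> x) \<bullet> (\<i> * \<psi> x)) * (\<psi>' x \<bullet> \<psi>' x)"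
        using Cauchy_Schwarz_ineq[of "\<i> * \<psi> x" "\<psi>' x"] J_eq[of x] by (simp add: J_def)
      also have "(\<i> * \<psi> x) \<bullet> (\<i> * \<psi> x) = q x" by (simp add: q_def inner_complex_def)
      finally show ?thesis by (simp add: p_def mult.commute)
    qed
    have "(q \<longlongrightarrow> 1 ^ 2) at_bot"
    proof -
      have "((\<lambda>x. \<psi> x - e x) \<longlongrightarrow> 0) at_bot" using lim_diff[OF lim_bot] by simp
      then have "((\<lambda>x. cmod (\<psi> x) - cmod (e x)) \<longlongrightarrow> 0) at_bot"
        by (rule Lim_null_comparison[rotated, OF tendsto_norm_zero])
          (auto intro!: always_eventually norm_triangle_ineq3)
      from tendsto_add[OF this tendsto_const[of 1]]
      have "((\<lambda>x. cmod (\<psi> x)) \<longlongrightarrow> 1) at_bot" by (simp add: norm1)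
      from tendsto_power[OF this, of 2] show ?thesis
        by (simp add: q_def[abs_def] power2_norm_eq_inner)
    qed
    then show "(q \<longlongrightarrow> 1) at_bot" by simp
    show "((\<lambda>x. (p x + \<omega> ^ 2 * q x - 2 * \<omega> ^ 2) / U x) \<longlongrightarrow> 0) at_bot"
    proof (rule Lim_null_comparison)
      have "((\<lambda>x. 4 * \<omega> ^ 2 * B ^ 2 * ((Y x) ^ 2 / U x)) \<longlongrightarrow> 4 * \<omega> ^ 2 * B ^ 2 * 0) at_bot"
        by (intro tendsto_intros Y_U_lim)
      then show "((\<lambda>x. 4 * \<omega> ^ 2 * B ^ 2 * ((Y x) ^ 2 / U x)) \<longlongrightarrow> 0) at_bot" by simp
      have "norm ((p x + \<omega> ^ 2 * q x - 2 * \<omega> ^ 2) / U x) \<le> 4 * \<omega> ^ 2 * B ^ 2 * ((Y x) ^ 2 / U x)" for x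
      proof -
        have "(cmod (b x)) ^ 2 \<le> (B * Y x) ^ 2" using b_le[of x] by (intro power_mono) auto
        then have "4 * \<omega> ^ 2 * (cmod (b x)) ^ 2 \<le> 4 * \<omega> ^ 2 * (B * Y x) ^ 2"
          by (intro mult_left_mono) auto
        then have "4 * \<omega> ^ 2 * (cmod (b x)) ^ 2 / U x \<le> 4 * \<omega> ^ 2 * (B * Y x) ^ 2 / U x"
          using U_pos[of x] by (intro divide_right_mono) auto
        moreover have "p x + \<omega> ^ 2 * q x - 2 * \<omega> ^ 2 = 4 * \<omega> ^ 2 * (cmod (b x)) ^ 2"
          unfolding energy unit by (simp add: algebra_simps)
        ultimately show ?thesis using U_pos[of x] by (simp add: power_mult_distrib)
      qed
      then show "\<forall>\<^sub>F x in at_bot. norm ((p x + \<omega> ^ 2 * q x - 2 * \<omega> ^ 2) / U x) \<le> 4 * \<omega> ^ 2 * B ^ 2 * ((Y x) ^ 2 / U x)"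
        by (intro always_eventually allI)
    qed
  qed (use \<omega> U' increasing decreasing U_pos peak in auto)
  define K where "K = \<omega> ^ 2 - U x0"
  have K: "K > 0" using peak by (simp add: K_def)
  \<comment> \<open>Individually \<open>p\<close> and \<open>q\<close> may keep oscillating at
    +infinity. The factor \<open>1 - U x / \<omega>^2\<close> costs only a nonnegative multiple of
    \<open>p\<close> and leaves an expression in the amplitudes and \<open>U\<close>, all of which
    converge.\<close>
  have "2 * \<omega> ^ 2 * (cmod (a x) ^ 2 + cmod (b x) ^ 2) * (1 - U x / \<omega> ^ 2) \<le> \<omega> ^ 2 * (\<omega> ^ 2 - U x) / K + K"
    if "x \<ge> x0" for x
  proof -
    have "2 * \<omega> ^ 2 * (cmod (a x) ^ 2 + cmod (b x) ^ 2) * (1 - U x / \<omega> ^ 2)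
        = (p x + \<omega> ^ 2 * q x) * (1 - U x / \<omega> ^ 2)" by (simp add: energy)
    also have "\<dots> = p x + (\<omega> ^ 2 - U x) * q x - p x * (U x / \<omega> ^ 2)"
      using \<omega> by (simp add: field_simps)
    also have "\<dots> \<le> p x + (\<omega> ^ 2 - U x) * q x" using nonneg(1)[of x] U_pos[of x] by simp
    finally show ?thesis using energy_bound_right[OF that] by (simp add: K_def)
  qed
  then have ev: "\<forall>\<^sub>F x in at_top. 2 * \<omega> ^ 2 * (cmod (a x) ^ 2 + cmod (b x) ^ 2) * (1 - U x / \<omega> ^ 2)
      \<le> \<omega> ^ 2 * (\<omega> ^ 2 - U x) / K + K"
    by (auto simp: eventually_at_top_linorder)
  have "2 * \<omega> ^ 2 * (cmod \<alpha> ^ 2 + cmod \<beta> ^ 2) * (1 - 0 / \<omega> ^ 2) \<le> \<omega> ^ 2 * (\<omega> ^ 2 - 0) / K + K"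
  proof (rule tendsto_le[OF trivial_limit_at_top_linorder _ _ ev])
    show "((\<lambda>x. \<omega> ^ 2 * (\<omega> ^ 2 - U x) / K + K) \<longlongrightarrow> \<omega> ^ 2 * (\<omega> ^ 2 - 0) / K + K) at_top"
      using K by (intro tendsto_intros U_lim) auto
    show "((\<lambda>x. 2 * \<omega> ^ 2 * (cmod (a x) ^ 2 + cmod (b x) ^ 2) * (1 - U x / \<omega> ^ 2))
        \<longlongrightarrow> 2 * \<omega> ^ 2 * (cmod \<alpha> ^ 2 + cmod \<beta> ^ 2) * (1 - 0 / \<omega> ^ 2)) at_top"
      using \<omega> by (intro tendsto_intros lim_top U_lim) auto
  qed
  moreover have "cmod \<alpha> ^ 2 = 1 + cmod \<beta> ^ 2"
  proof -
    have "((\<lambda>x. cmod (a x) ^ 2) \<longlongrightarrow> 1 + cmod \<beta> ^ 2) at_top"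
      unfolding unit by (intro tendsto_intros lim_top)
    moreover have "((\<lambda>x. cmod (a x) ^ 2) \<longlongrightarrow> cmod \<alpha> ^ 2) at_top"
      by (intro tendsto_intros lim_top)
    ultimately show ?thesis using tendsto_unique[OF trivial_limit_at_top_linorder] by blast
  qed
  ultimately have "4 * \<omega> ^ 2 * cmod \<alpha> ^ 2 \<le> \<omega> ^ 2 * \<omega> ^ 2 / K + K + 2 * \<omega> ^ 2" and \<alpha>: "cmod \<alpha> ^ 2 > 0"
    by (auto simp: algebra_simps add_pos_nonneg)
  then have "(4 * \<omega> ^ 2 * cmod \<alpha> ^ 2) * K \<le> (\<omega> ^ 2 * \<omega> ^ 2 / K + K + 2 * \<omega> ^ 2) * K"
    using K by (intro mult_right_mono) auto
  also have "\<dots> = (\<omega> ^ 2 + K) ^ 2"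
    using K by (simp add: distrib_right power2_eq_square algebra_simps)
  finally have "4 * \<omega> ^ 2 * K * cmod \<alpha> ^ 2 \<le> (\<omega> ^ 2 + K) ^ 2" by (simp add: mult_ac)
  moreover have "\<omega> ^ 2 + K > 0" using K by (simp add: add_nonneg_pos)
  then have "(\<omega> ^ 2 + K) ^ 2 > 0" by simp
  ultimately have "4 * \<omega> ^ 2 * K / (\<omega> ^ 2 + K) ^ 2 \<le> 1 / cmod \<alpha> ^ 2"
    using \<alpha> by (simp add: divide_simps)
  then show ?thesis by (simp add: T K_def)
qed

section \<open>The tortoise coordinate\<close>

locale schwarzschild =
  fixes m :: real
  assumes m: "m > 0"
begin

abbreviation (input) R :: "real \<Rightarrow> real" where "R \<equiv> radius_of_tortoise m"

lemma tortoise_deriv: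
  assumes r: "r > 2 * m"
  shows "(tortoise m has_real_derivative 1 / (1 - 2 * m / r)) (at r)"
proof -
  have "r > 0" using r m by linarith
  then show ?thesis
    unfolding tortoise_def using r m
    by (auto intro!: derivative_eq_intros simp: divide_simps)
qed

lemma tortoise_less:
  assumes "2 * m < r" "r < r'"
  shows "tortoise m r < tortoise m r'"
proof (rule DERIV_pos_imp_increasing[OF \<open>r < r'\<close>])
  fix x assume "r \<le> x"
  then have "x > 2 * m" "x > 0" using assms m by auto
  then show "\<exists>d. (tortoise m has_real_derivative d) (at x) \<and> d > 0"
    by (intro exI[of _ "1 / (1 - 2 * m / x)"] conjI tortoise_deriv) (simp_all add: divide_simps)
qed

lemma tortoise_inj: "inj_on (tortoise m) {2 * m<..}"
  by (rule linorder_inj_onI') (auto dest: tortoise_less)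

lemma continuous_on_tortoise: "continuous_on {2 * m<..} (tortoise m)"
  by (rule DERIV_continuous_on) (auto intro: has_field_derivative_at_within tortoise_deriv)

lemma tortoise_surj: "tortoise m ` {2 * m<..} = UNIV"
proof (intro equalityI subset_UNIV subsetI)
  fix x :: real
  \<comment> \<open>An exponentially small distance from the horizon turns the logarithm into
    \<open>- t\<close>, and \<open>t\<close> is chosen to push the value below \<open>x\<close>. For
    \<open>r2\<close>, radius at least \<open>4 * m\<close> makes the logarithm nonnegative.\<close>
  define t where "t = max 0 ((4 * m - x) / (2 * m))"
  define r1 where "r1 = 2 * m + 2 * m * exp (- t)"
  define r2 where "r2 = max x (4 * m)"
  have r1: "2 * m < r1" "r1 \<le> 4 * m" using m by (auto simp: r1_def t_def)
  have "tortoise m r1 = r1 - 2 * m * t" using m by (simp add: tortoise_def r1_def)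
  also have "\<dots> \<le> 4 * m - 2 * m * ((4 * m - x) / (2 * m))"
    using r1 m by (intro diff_mono mult_left_mono) (auto simp: t_def)
  also have "\<dots> = x" using m by simp
  finally have "tortoise m r1 \<le> x" .
  moreover have "x \<le> tortoise m r2"
  proof -
    have "1 \<le> (r2 - 2 * m) / (2 * m)" using m by (simp add: r2_def divide_simps max_def)
    then have "0 \<le> 2 * m * ln ((r2 - 2 * m) / (2 * m))" using m by simp
    then show ?thesis by (simp add: tortoise_def r2_def)
  qed
  moreover have "r1 \<le> r2" using r1 by (simp add: r2_def)
  moreover have "continuous_on {r1..r2} (tortoise m)"
    by (rule continuous_on_subset[OF continuous_on_tortoise]) (use r1 in auto)
  ultimately obtain r where "r1 \<le> r" "tortoise m r = x"
    using IVT'[of "tortoise m" r1 x r2] by blast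
  then show "x \<in> tortoise m ` {2 * m<..}" using r1 by (intro image_eqI[of _ _ r]) auto
qed

lemma radius_gt: "R x > 2 * m"
  using the_inv_into_into[OF tortoise_inj, of x "{2 * m<..}"]
  by (simp add: tortoise_surj radius_of_tortoise_def)

lemma radius_pos: "R x > 0"
  using radius_gt[of x] m by linarith

lemma tortoise_radius [simp]: "tortoise m (R x) = x"
  by (simp add: radius_of_tortoise_def f_the_inv_into_f[OF tortoise_inj] tortoise_surj)

lemma radius_tortoise: "r > 2 * m \<Longrightarrow> R (tortoise m r) = r"
  by (simp add: radius_of_tortoise_def the_inv_into_f_f[OF tortoise_inj])

lemma radius_less_iff:
  assumes "r > 2 * m"
  shows "R x < r \<longleftrightarrow> x < tortoise m r"
  using tortoise_less[of "R x" r] tortoise_less[of r "R x"] assms radius_gt[of x]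
  by (metis less_asym linorder_neqE_linordered_idom tortoise_radius)

lemma radius_le_iff:
  assumes "r > 2 * m"
  shows "R x \<le> r \<longleftrightarrow> x \<le> tortoise m r"
  using radius_less_iff[OF assms, of x] radius_tortoise[OF assms]
  by (metis order_le_less tortoise_radius)

lemma radius_deriv: "(R has_real_derivative 1 - 2 * m / R x) (at x)"
proof -
  have "(R has_real_derivative inverse (1 / (1 - 2 * m / R x))) (at x)"
  proof (rule DERIV_inverse_function[where f = "tortoise m" and a = "x - 1" and b = "x + 1"])
    show "(tortoise m has_real_derivative 1 / (1 - 2 * m / R x)) (at (R x))"
      by (rule tortoise_deriv[OF radius_gt])
    show "1 / (1 - 2 * m / R x) \<noteq> 0" using radius_gt[of x] radius_pos[of x] by simp
    show "isCont R x"
    proof -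
      define d where "d = R x - 2 * m"
      have d: "d > 0" using radius_gt by (simp add: d_def)
      have "isCont R (tortoise m (R x))"
      proof (rule isCont_inverse_function[where f = "tortoise m" and x = "R x" and d = "d / 2"])
        show "R (tortoise m z) = z" if "\<bar>z - R x\<bar> \<le> d / 2" for z
          using that d by (intro radius_tortoise) (simp add: d_def abs_if split: if_splits)
        show "isCont (tortoise m) z" if "\<bar>z - R x\<bar> \<le> d / 2" for z
          using that d by (intro DERIV_isCont[OF tortoise_deriv]) (simp add: d_def abs_if split: if_splits)
      qed (use d in auto)
      then show ?thesis by simp
    qed
  qed auto
  then show ?thesis by simp
qed

lemma radius_at_bot: "(R \<longlongrightarrow> 2 * m) at_bot"
proof (rule order_tendstoI)
  fix r assume "r > 2 * m"
  then have "R x < r" if "x \<le> tortoise m r - 1" for x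
    using that by (simp add: radius_less_iff)
  then show "\<forall>\<^sub>F x in at_bot. R x < r" by (auto simp: eventually_at_bot_linorder)
next
  fix r assume "r < 2 * m"
  then show "\<forall>\<^sub>F x in at_bot. r < R x"
    using radius_gt by (intro always_eventually allI) (meson less_trans)
qed

lemma radius_at_top: "filterlim R at_top at_top"
  unfolding filterlim_at_top
proof
  fix r :: real
  define r' where "r' = max r (2 * m + 1)"
  have "r \<le> R x" if "x \<ge> tortoise m r'" for x
  proof -
    have "\<not> R x < r'" using that by (subst radius_less_iff) (auto simp: r'_def)
    then show ?thesis by (simp add: r'_def)
  qed
  then show "\<forall>\<^sub>F x in at_top. r \<le> R x" by (auto simp: eventually_at_top_linorder)
qed

end

section \<open>The Regge-Wheeler barrier\<close>

context schwarzschild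
begin

text \<open>In this variable the potential is a polynomial; the horizon is at 1, spatial infinity at
  0, so orientation is reversed.\<close>

definition compactness :: "real \<Rightarrow> real" where "compactness x = 2 * m / R x"

lemma compactness_bounds: "0 < compactness x" "compactness x < 1"
  using radius_gt[of x] radius_pos[of x] m by (auto simp: compactness_def)

lemma compactness_deriv:
  "(compactness has_real_derivative - (compactness x ^ 2 * (1 - compactness x) / (2 * m))) (at x)"
proof -
  have "(compactness has_real_derivative
      (0 * R x - 2 * m * (1 - 2 * m / R x)) / (R x * R x)) (at x)"
    unfolding compactness_def using radius_pos[of x]
    by (intro DERIV_divide DERIV_const radius_deriv) auto
  then show ?thesis
    by (rule DERIV_cong) (use m radius_pos[of x] in \<open>simp add: compactness_def power2_eq_square divide_simps\<close>)
qed

lemma compactness_at_bot: "(compactness \<longlongrightarrow> 1) at_bot"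
proof -
  have "(compactness \<longlongrightarrow> 2 * m / (2 * m)) at_bot"
    unfolding compactness_def by (intro tendsto_intros radius_at_bot) (use m in auto)
  then show ?thesis using m by simp
qed

lemma compactness_at_top: "(compactness \<longlongrightarrow> 0) at_top"
  unfolding compactness_def
  by (rule tendsto_divide_0[OF tendsto_const filterlim_at_top_imp_at_infinity[OF radius_at_top]])

lemma compactness_le_iff:
  assumes "0 < t" "t < 1"
  shows "compactness x \<le> t \<longleftrightarrow> tortoise m (2 * m / t) \<le> x"
proof -
  have "2 * m / t > 2 * m" using assms m by (simp add: divide_simps)
  from radius_less_iff[OF this, of x] show ?thesis
    using assms radius_pos[of x] by (auto simp: compactness_def divide_simps mult.commute not_less[symmetric])
qed

lemma compactness_ge_iff:
  assumes "0 < t" "t < 1"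
  shows "t \<le> compactness x \<longleftrightarrow> x \<le> tortoise m (2 * m / t)"
proof -
  have "2 * m / t > 2 * m" using assms m by (simp add: divide_simps)
  from radius_le_iff[OF this, of x] show ?thesis
    using assms radius_pos[of x] by (auto simp: compactness_def divide_simps mult.commute)
qed

text \<open>Here \<open>L\<close> stands for \<open>l * (l + 1)\<close> and \<open>\<sigma>\<close>
  for \<open>1 - s^2\<close>; the denominator comes from
  \<open>1 / r^2 = t^2 / (4 * m^2)\<close>.\<close>

definition reduced_potential :: "real \<Rightarrow> real \<Rightarrow> real \<Rightarrow> real" where
  "reduced_potential L \<sigma> t = t ^ 2 * (1 - t) * (L + \<sigma> * t) / (4 * m ^ 2)"

lemma regge_wheeler_potential_radius:
  "regge_wheeler_potential m s l (R x)
    = reduced_potential (real l * (real l + 1)) (1 - (real s) ^ 2) (compactness x)"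
  using m radius_pos[of x]
  by (simp add: regge_wheeler_potential_def reduced_potential_def compactness_def power2_eq_square
      power3_eq_cube divide_simps)

text \<open>Since \<open>compactness\<close> decreases along the line, \<open>above\<close> yields
  the rising flank to the left of the peak and \<open>below\<close> the falling flank to its
  right.\<close>

lemma transmission_probability_ge_unimodal:
  fixes L \<sigma> \<omega> t0 :: real
  assumes \<omega>: "\<omega> > 0" and L: "L \<ge> 0" "L + \<sigma> > 0"
    and t0: "0 < t0" "t0 < 1"
    and below: "\<And>t. 0 < t \<Longrightarrow> t \<le> t0 \<Longrightarrow> 0 \<le> 2 * L + 3 * (\<sigma> - L) * t - 4 * \<sigma> * t ^ 2"
    and above: "\<And>t. t0 \<le> t \<Longrightarrow> t < 1 \<Longrightarrow> 2 * L + 3 * (\<sigma> - L) * t - 4 * \<sigma> * t ^ 2 \<le> 0"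
    and peak: "reduced_potential L \<sigma> t0 < \<omega> ^ 2"
  shows "transmission_probability \<omega> (\<lambda>x. reduced_potential L \<sigma> (compactness x))
    \<ge> 4 * \<omega> ^ 2 * (\<omega> ^ 2 - reduced_potential L \<sigma> t0) / (2 * \<omega> ^ 2 - reduced_potential L \<sigma> t0) ^ 2"
proof -
  define A where "A = 1 / (2 * m)"
  define x0 where "x0 = tortoise m (2 * m / t0)"
  have x0: "compactness x0 = t0"
    using compactness_le_iff[OF t0, of x0] compactness_ge_iff[OF t0, of x0] by (simp add: x0_def)
  have A: "A > 0" "2 * m * A = 1" using m by (auto simp: A_def)
  let ?g = "\<lambda>t. 2 * L + 3 * (\<sigma> - L) * t - 4 * \<sigma> * t ^ 2"
  let ?U = "\<lambda>x. reduced_potential L \<sigma> (compactness x)"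
  let ?c = compactness
  have pos: "L + \<sigma> * t > 0" if "0 < t" "t \<le> 1" for t
  proof (cases "\<sigma> \<le> 0")
    case True
    then have "\<sigma> * t \<ge> \<sigma>" using that by (simp add: mult_le_cancel_left1)
    then show ?thesis using L by linarith
  next
    case False
    then show ?thesis using that L by (simp add: add_nonneg_pos)
  qed
  have "transmission_probability \<omega> ?U
      \<ge> 4 * \<omega> ^ 2 * (\<omega> ^ 2 - ?U x0) / (2 * \<omega> ^ 2 - ?U x0) ^ 2"
  \<comment> \<open>\<open>Y\<close> is \<open>1 / (2 * m) - 1 / r\<close>, whose derivative
    \<open>(1 - 2 * m / r) / r^2\<close> is a factor of the potential; the cofactor
    \<open>L + \<sigma> * t\<close> is \<open>P\<close>. \<open>X\<close> recovers the tortoise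
    coordinate from \<open>r = 1 / (A - y)\<close>, and \<open>W\<close> integrates the potential
    explicitly.\<close>
  proof (rule transmission_probability_ge[OF \<omega>,
        where A = A and X = "\<lambda>y. tortoise m (1 / (A - y))" and P = "\<lambda>y. L + \<sigma> * (2 * m * (A - y))"
          and N = "L + \<bar>\<sigma>\<bar>" and Y = "\<lambda>x. A * (1 - ?c x)" and Y' = "\<lambda>x. ?c x ^ 2 * (1 - ?c x) / (4 * m ^ 2)"
          and U' = "\<lambda>x. - (?c x ^ 3 * (1 - ?c x) * ?g (?c x) / (8 * m ^ 3))"
          and W = "\<lambda>x. - (L * ?c x + \<sigma> * ?c x ^ 2 / 2) / (2 * m)" and w = "- (L * 1 + \<sigma> * 1 ^ 2 / 2) / (2 * m)"])
    show "continuous_on {0<..<A} (\<lambda>y. tortoise m (1 / (A - y)))"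
    proof (rule continuous_on_compose2[OF continuous_on_tortoise])
      show "continuous_on {0<..<A} (\<lambda>y. 1 / (A - y))"
        by (intro continuous_intros) auto
      have "1 / (A - y) > 2 * m" if "0 < y" "y < A" for y
      proof -
        have "2 * m * (A - y) < 1" using that m A by (simp add: right_diff_distrib)
        then show ?thesis using that by (simp add: divide_simps)
      qed
      then show "(\<lambda>y. 1 / (A - y)) ` {0<..<A} \<subseteq> {2 * m<..}" by auto
    qed
    show "continuous_on {0<..<A} (\<lambda>y. L + \<sigma> * (2 * m * (A - y)))" by (intro continuous_intros)
    show "\<bar>L + \<sigma> * (2 * m * (A - y))\<bar> \<le> L + \<bar>\<sigma>\<bar>" if "y \<in> {0<..<A}" for y
    proof -
      have "0 \<le> 2 * m * (A - y)" using that m by simp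
      moreover have "0 \<le> 2 * m * y" using that m by simp
      then have "2 * m * (A - y) \<le> 1" using A by (simp add: right_diff_distrib)
      ultimately have "\<bar>\<sigma> * (2 * m * (A - y))\<bar> \<le> \<bar>\<sigma>\<bar> * 1"
        unfolding abs_mult[of \<sigma>] by (intro mult_left_mono) auto
      then show ?thesis using L by linarith
    qed
    show "A * (1 - ?c x) \<in> {0<..<A}" for x using A compactness_bounds[of x] by simp
    show "tortoise m (1 / (A - A * (1 - ?c x))) = x" for x
    proof -
      have "1 / (A - A * (1 - ?c x)) = R x" using m radius_pos[of x]
        by (simp add: A_def compactness_def right_diff_distrib)
      then show ?thesis by simp
    qed
    show "((\<lambda>x. A * (1 - ?c x)) has_real_derivative ?c x ^ 2 * (1 - ?c x) / (4 * m ^ 2)) (at x)" for x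
      by (rule DERIV_cong[OF DERIV_cmult[OF DERIV_diff[OF DERIV_const compactness_deriv]]])
        (use m in \<open>simp add: A_def power2_eq_square\<close>)
    have "((\<lambda>x. A * (1 - ?c x)) \<longlongrightarrow> A * (1 - 1)) at_bot"
      by (intro tendsto_intros compactness_at_bot)
    then show "((\<lambda>x. A * (1 - ?c x)) \<longlongrightarrow> 0) at_bot" by simp
    have "((\<lambda>x. A * (1 - ?c x)) \<longlongrightarrow> A * (1 - 0)) at_top"
      by (intro tendsto_intros compactness_at_top)
    then show "((\<lambda>x. A * (1 - ?c x)) \<longlongrightarrow> A) at_top" by simp
    show "?U x = ?c x ^ 2 * (1 - ?c x) / (4 * m ^ 2) * (L + \<sigma> * (2 * m * (A - A * (1 - ?c x))))" for x
    proof -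
      have "2 * m * (A - A * (1 - ?c x)) = 2 * m * A * ?c x" by (simp add: algebra_simps)
      then show ?thesis using A by (simp add: reduced_potential_def)
    qed
    show "(?U has_real_derivative - (?c x ^ 3 * (1 - ?c x) * ?g (?c x) / (8 * m ^ 3))) (at x)" for x
    proof -
      have "(reduced_potential L \<sigma> has_real_derivative t * ?g t / (4 * m ^ 2)) (at t)" for t
        unfolding reduced_potential_def using m
        by (auto intro!: derivative_eq_intros simp: power2_eq_square algebra_simps add_divide_distrib diff_divide_distrib)
      from DERIV_chain2[OF this compactness_deriv]
      show ?thesis by (rule DERIV_cong) (simp add: power2_eq_square power3_eq_cube mult_ac)
    qed
    show "0 \<le> - (?c x ^ 3 * (1 - ?c x) * ?g (?c x) / (8 * m ^ 3))" if "x \<le> x0" for x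
    proof -
      have "t0 \<le> ?c x" using that compactness_ge_iff[OF t0] by (simp add: x0_def)
      then have "?g (?c x) \<le> 0" using above compactness_bounds by simp
      moreover have "0 \<le> ?c x ^ 3 * (1 - ?c x) / (8 * m ^ 3)" using compactness_bounds[of x] m by simp
      ultimately have "?c x ^ 3 * (1 - ?c x) / (8 * m ^ 3) * ?g (?c x) \<le> 0"
        by (rule mult_nonneg_nonpos[rotated])
      then show ?thesis by simp
    qed
    show "- (?c x ^ 3 * (1 - ?c x) * ?g (?c x) / (8 * m ^ 3)) \<le> 0" if "x \<ge> x0" for x
    proof -
      have "?c x \<le> t0" using that compactness_le_iff[OF t0] by (simp add: x0_def)
      then have "?g (?c x) \<ge> 0" using below compactness_bounds by simp
      moreover have "0 \<le> ?c x ^ 3 * (1 - ?c x) / (8 * m ^ 3)" using compactness_bounds[of x] m by simp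
      ultimately have "?c x ^ 3 * (1 - ?c x) / (8 * m ^ 3) * ?g (?c x) \<ge> 0"
        by (rule mult_nonneg_nonneg[rotated])
      then show ?thesis by simp
    qed
    show "?U x > 0" for x
      using compactness_bounds[of x] pos[of "?c x"] m by (simp add: reduced_potential_def)
    show "?U x0 < \<omega> ^ 2" using peak x0 by simp
    have lim: "(?U \<longlongrightarrow> reduced_potential L \<sigma> t) F" if "(compactness \<longlongrightarrow> t) F" for t F
      unfolding reduced_potential_def using m by (intro tendsto_intros that) auto
    show "(?U \<longlongrightarrow> 0) at_bot" using lim[OF compactness_at_bot] by (simp add: reduced_potential_def)
    show "(?U \<longlongrightarrow> 0) at_top" using lim[OF compactness_at_top] by (simp add: reduced_potential_def)
    \<comment> \<open>At the horizon \<open>Y^2\<close> vanishes to second order in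
      \<open>1 - t\<close> but the potential only to first order, because
      \<open>L + \<sigma> > 0\<close>.\<close>
    have "((\<lambda>x. (1 - ?c x) / (?c x ^ 2 * (L + \<sigma> * ?c x))) \<longlongrightarrow> (1 - 1) / (1 ^ 2 * (L + \<sigma> * 1))) at_bot"
      using L by (intro tendsto_intros compactness_at_bot) auto
    moreover have "(A * (1 - ?c x)) ^ 2 / ?U x = (1 - ?c x) / (?c x ^ 2 * (L + \<sigma> * ?c x))" for x
      using compactness_bounds[of x] pos[of "?c x"] m
      by (simp add: A_def reduced_potential_def power2_eq_square)
    ultimately show "((\<lambda>x. (A * (1 - ?c x)) ^ 2 / ?U x) \<longlongrightarrow> 0) at_bot" by simp
    show "((\<lambda>x. - (L * ?c x + \<sigma> * ?c x ^ 2 / 2) / (2 * m)) has_real_derivative ?U x) (at x)" for x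
    proof -
      have "((\<lambda>t. - (L * t + \<sigma> * t ^ 2 / 2) / (2 * m)) has_real_derivative - ((L + \<sigma> * t) / (2 * m))) (at t)" for t
        using m by (auto intro!: derivative_eq_intros simp: divide_simps)
      from DERIV_chain2[OF this compactness_deriv]
      show ?thesis
        by (rule DERIV_cong) (simp add: reduced_potential_def power2_eq_square mult_ac)
    qed
    show "((\<lambda>x. - (L * ?c x + \<sigma> * ?c x ^ 2 / 2) / (2 * m)) \<longlongrightarrow> - (L * 1 + \<sigma> * 1 ^ 2 / 2) / (2 * m)) at_bot"
      using m by (intro tendsto_intros compactness_at_bot) auto
  qed
  then show ?thesis by (simp add: x0)
qed

text \<open>
  The quadratic is the derivative of \<open>t\<^sup>2 * (1 - t) * (L + \<sigma> * t)\<close> divided by \<open>t\<close>.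
\<close>

lemma single_critical_point:
  fixes L \<sigma> :: real
  assumes L: "L \<ge> 0" "L + \<sigma> > 0"
  obtains t0 where "0 < t0" "t0 < 1"
    and "\<And>t. 0 < t \<Longrightarrow> t \<le> t0 \<Longrightarrow> 0 \<le> 2 * L + 3 * (\<sigma> - L) * t - 4 * \<sigma> * t ^ 2"
    and "\<And>t. t0 \<le> t \<Longrightarrow> t < 1 \<Longrightarrow> 2 * L + 3 * (\<sigma> - L) * t - 4 * \<sigma> * t ^ 2 \<le> 0"
\<comment> \<open>For \<open>L = 0\<close> the quadratic itself vanishes at \<open>t = 0\<close>, so
  the sign change needed for the intermediate value argument is missing; its other root is
  \<open>3 / 4\<close>.\<close>
proof (cases "L = 0")
  case True
  have g: "2 * L + 3 * (\<sigma> - L) * t - 4 * \<sigma> * t ^ 2 = \<sigma> * t * (3 - 4 * t)" for t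
    by (simp add: True power2_eq_square algebra_simps)
  show ?thesis
  proof (rule that[of "3 / 4"])
    show "0 \<le> 2 * L + 3 * (\<sigma> - L) * t - 4 * \<sigma> * t ^ 2" if "0 < t" "t \<le> 3 / 4" for t
      unfolding g using L True that by (intro mult_nonneg_nonneg) auto
    show "2 * L + 3 * (\<sigma> - L) * t - 4 * \<sigma> * t ^ 2 \<le> 0" if "3 / 4 \<le> t" "t < 1" for t
      unfolding g using L True that by (intro mult_nonneg_nonpos mult_nonneg_nonneg) auto
  qed auto
next
  case False
  define g where "g t = 2 * L + 3 * (\<sigma> - L) * t - 4 * \<sigma> * t ^ 2" for t
  have g01: "g 0 > 0" "g 1 < 0" using False L by (auto simp: g_def)
  have "\<exists>t\<ge>0. t \<le> 1 \<and> g t = 0"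
    using g01 by (intro IVT2') (auto simp: g_def intro!: continuous_intros)
  then obtain t0 where t0: "0 \<le> t0" "t0 \<le> 1" "g t0 = 0" by blast
  then have "t0 \<noteq> 0" "t0 \<noteq> 1" using g01 by auto
  then have t01: "0 < t0" "t0 < 1" using t0 by auto
  \<comment> \<open>The cofactor of the root \<open>t0\<close> is affine and negative at both ends
    of the unit interval, which excludes a second sign change.\<close>
  define h where "h t = 3 * (\<sigma> - L) - 4 * \<sigma> * (t + t0)" for t
  have factor: "g t = (t - t0) * h t" for t
  proof -
    have "g t - g t0 = (t - t0) * h t" by (simp add: g_def h_def power2_eq_square algebra_simps)
    then show ?thesis using t0 by simp
  qed
  have "h 0 < 0" using factor[of 0] g01 t01 by (simp add: mult_less_0_iff)
  moreover have "h 1 < 0" using factor[of 1] g01 t01 by (simp add: mult_less_0_iff)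
  ultimately have h: "h t \<le> 0" if "0 \<le> t" "t \<le> 1" for t
  proof -
    have "h t = (1 - t) * h 0 + t * h 1" by (simp add: h_def algebra_simps)
    also have "\<dots> \<le> 0" using that \<open>h 0 < 0\<close> \<open>h 1 < 0\<close>
      by (intro add_nonpos_nonpos mult_nonneg_nonpos) auto
    finally show ?thesis .
  qed
  show ?thesis
  proof (rule that[OF t01])
    show "0 \<le> 2 * L + 3 * (\<sigma> - L) * t - 4 * \<sigma> * t ^ 2" if "0 < t" "t \<le> t0" for t
      using factor[of t] h[of t] that t01 by (simp add: g_def mult_nonpos_nonpos)
    show "2 * L + 3 * (\<sigma> - L) * t - 4 * \<sigma> * t ^ 2 \<le> 0" if "t0 \<le> t" "t < 1" for t
      using factor[of t] h[of t] that t01 by (simp add: g_def mult_nonneg_nonpos)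
  qed
qed

end

section \<open>From estimates of the peak height to greybody bounds\<close>

lemma square_barrier_bound_eq:
  fixes E V :: real
  assumes "V < 2 * E"
  shows "4 * E * (E - V) / (2 * E - V) ^ 2 = 1 - (V / (2 * E - V)) ^ 2"
proof -
  have "(2 * E - V) ^ 2 \<noteq> 0" using assms by simp
  moreover have "4 * E * (E - V) = (2 * E - V) ^ 2 - V ^ 2" by (simp add: power2_eq_square algebra_simps)
  ultimately show ?thesis by (simp add: power_divide diff_divide_distrib)
qed

text \<open>In the form \<open>1 - (V / (2 * E - V))^2\<close> the dependence on \<open>V\<close> is
  plain, as the quotient grows with \<open>V\<close>. The exact peak, which is not computed in
  general, may thus be replaced by an upper estimate.\<close>

lemma square_barrier_bound_antimono:
  fixes E V M :: real
  assumes "0 \<le> V" "V \<le> M" "M < E"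
  shows "4 * E * (E - M) / (2 * E - M) ^ 2 \<le> 4 * E * (E - V) / (2 * E - V) ^ 2"
    and "V < M \<Longrightarrow> 4 * E * (E - M) / (2 * E - M) ^ 2 < 4 * E * (E - V) / (2 * E - V) ^ 2"
proof -
  have eq: "4 * E * (E - M) / (2 * E - M) ^ 2 = 1 - (M / (2 * E - M)) ^ 2"
    "4 * E * (E - V) / (2 * E - V) ^ 2 = 1 - (V / (2 * E - V)) ^ 2"
    using assms by (intro square_barrier_bound_eq; linarith)+
  have "V / (2 * E - V) \<le> M / (2 * E - M)" using assms by (intro frac_le) auto
  then have "(V / (2 * E - V)) ^ 2 \<le> (M / (2 * E - M)) ^ 2" using assms by (intro power_mono) auto
  then show "4 * E * (E - M) / (2 * E - M) ^ 2 \<le> 4 * E * (E - V) / (2 * E - V) ^ 2"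
    unfolding eq by simp
  assume "V < M"
  then have "V / (2 * E - V) < M / (2 * E - M)" using assms by (intro frac_less) auto
  then have "(V / (2 * E - V)) ^ 2 < (M / (2 * E - M)) ^ 2" using assms by (intro power_strict_mono) auto
  then show "4 * E * (E - M) / (2 * E - M) ^ 2 < 4 * E * (E - V) / (2 * E - V) ^ 2"
    unfolding eq by simp
qed

text \<open>The polynomial hypothesis says that the potential stays below
  \<open>M = \<kappa> / (c * m^2)\<close>; scaling the bound at \<open>M\<close> by
  \<open>(c * m^2)^2\<close> gives \<open>bound\<close>. Separate \<open>c2\<close> and
  \<open>c4\<close> let the numerals of each case match by unification.\<close>

lemma greybody_factor_ge:
  fixes m \<omega> c c2 c4 \<kappa> :: real and s l :: nat
  defines "L \<equiv> real l * (real l + 1)" and "\<sigma> \<equiv> 1 - (real s) ^ 2"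
  defines "bound \<equiv> c4 * \<omega> ^ 2 * m ^ 2 * (c * \<omega> ^ 2 * m ^ 2 - \<kappa>) / (c2 * \<omega> ^ 2 * m ^ 2 - \<kappa>) ^ 2"
  assumes "m > 0" "\<omega> > 0" "s \<le> l" and c: "c > 0" "c2 = 2 * c" "c4 = 4 * c"
    and numerator: "c4 * \<omega> ^ 2 * m ^ 2 * (c * \<omega> ^ 2 * m ^ 2 - \<kappa>) > 0"
  shows "(\<And>t. 0 < t \<Longrightarrow> t < 1 \<Longrightarrow> c * (t ^ 2 * (1 - t) * (L + \<sigma> * t)) \<le> 4 * \<kappa>) \<Longrightarrow>
      greybody_factor m \<omega> s l \<ge> bound"
    and "(\<And>t. 0 < t \<Longrightarrow> t < 1 \<Longrightarrow> c * (t ^ 2 * (1 - t) * (L + \<sigma> * t)) < 4 * \<kappa>) \<Longrightarrow>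
      greybody_factor m \<omega> s l > bound"
proof -
  interpret schwarzschild m by unfold_locales fact
  have L: "L \<ge> 0" by (simp add: L_def)
  \<comment> \<open>The condition \<open>s \<le> l\<close> gives
    \<open>L + \<sigma> \<ge> l + 1\<close>, hence positivity of the potential up to the
    horizon.\<close>
  have "(real s) ^ 2 \<le> (real l) ^ 2" using \<open>s \<le> l\<close> by (intro power_mono) auto
  then have L\<sigma>: "L + \<sigma> > 0" by (simp add: L_def \<sigma>_def power2_eq_square distrib_left)
  obtain t0 where t0: "0 < t0" "t0 < 1"
    and "\<And>t. 0 < t \<Longrightarrow> t \<le> t0 \<Longrightarrow> 0 \<le> 2 * L + 3 * (\<sigma> - L) * t - 4 * \<sigma> * t ^ 2"
    and "\<And>t. t0 \<le> t \<Longrightarrow> t < 1 \<Longrightarrow> 2 * L + 3 * (\<sigma> - L) * t - 4 * \<sigma> * t ^ 2 \<le> 0"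
    using single_critical_point[OF L L\<sigma>] by blast
  note T = transmission_probability_ge_unimodal[OF \<open>\<omega> > 0\<close> L L\<sigma> this]
  define V where "V = reduced_potential L \<sigma> t0"
  define M where "M = \<kappa> / (c * m ^ 2)"
  have cm: "c * m ^ 2 > 0" using \<open>m > 0\<close> c by simp
  have greybody: "greybody_factor m \<omega> s l = transmission_probability \<omega> (\<lambda>x. reduced_potential L \<sigma> (compactness x))"
    by (simp add: greybody_factor_def regge_wheeler_potential_radius L_def \<sigma>_def)
  have V: "V \<ge> 0"
  proof -
    have "L + \<sigma> * t0 = (1 - t0) * L + t0 * (L + \<sigma>)" by (simp add: algebra_simps)
    also have "\<dots> \<ge> 0" using L L\<sigma> t0 by simp
    finally show ?thesis using t0 by (simp add: V_def reduced_potential_def)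
  qed
  have "c * \<omega> ^ 2 * m ^ 2 - \<kappa> > 0"
    using zero_less_mult_pos[OF numerator] assms(4,5) c by simp
  then have M: "M < \<omega> ^ 2" using cm by (simp add: M_def divide_simps mult_ac)
  have VM: "V = c * (t0 ^ 2 * (1 - t0) * (L + \<sigma> * t0)) / (4 * (c * m ^ 2))" "M = 4 * \<kappa> / (4 * (c * m ^ 2))"
    using \<open>c > 0\<close> by (simp_all add: V_def reduced_potential_def M_def)
  have bound: "bound = 4 * \<omega> ^ 2 * (\<omega> ^ 2 - M) / (2 * \<omega> ^ 2 - M) ^ 2"
  proof -
    define d where "d = c * m ^ 2"
    have d: "d > 0" "\<kappa> = d * M" using cm by (auto simp: d_def M_def)
    have "bound = (4 * \<omega> ^ 2 * (\<omega> ^ 2 - M)) * d ^ 2 / ((2 * \<omega> ^ 2 - M) ^ 2 * d ^ 2)"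
      unfolding bound_def c(2,3) d(2) d_def
      by (rule arg_cong2[where f = divide]) (simp_all add: power2_eq_square algebra_simps)
    also have "\<dots> = 4 * \<omega> ^ 2 * (\<omega> ^ 2 - M) / (2 * \<omega> ^ 2 - M) ^ 2" using d by simp
    finally show ?thesis .
  qed
  show "greybody_factor m \<omega> s l \<ge> bound"
    if "\<And>t. 0 < t \<Longrightarrow> t < 1 \<Longrightarrow> c * (t ^ 2 * (1 - t) * (L + \<sigma> * t)) \<le> 4 * \<kappa>"
  proof -
    have "V \<le> M" unfolding VM using that[OF t0] cm by (intro divide_right_mono) auto
    then show ?thesis
      using T square_barrier_bound_antimono(1)[OF V _ M] M unfolding greybody bound V_def by linarith
  qed
  show "greybody_factor m \<omega> s l > bound"
    if "\<And>t. 0 < t \<Longrightarrow> t < 1 \<Longrightarrow> c * (t ^ 2 * (1 - t) * (L + \<sigma> * t)) < 4 * \<kappa>"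
  proof -
    have "V < M" unfolding VM using that[OF t0] cm by (intro divide_strict_right_mono) auto
    then show ?thesis
      using T square_barrier_bound_antimono(2)[OF V less_imp_le M] M unfolding greybody bound V_def by linarith
  qed
qed

section \<open>Polynomial estimates of the peak height\<close>

text \<open>The maximum is at \<open>t = 2 / 3\<close>, the photon sphere \<open>r = 3 * m\<close>;
  it appears as a double root of the difference.\<close>

lemma photon_sphere_bound:
  fixes t :: real
  assumes "0 \<le> t"
  shows "27 * (t ^ 2 * (1 - t)) \<le> 4"
proof -
  have "4 - 27 * (t ^ 2 * (1 - t)) = (3 * t - 2) ^ 2 * (3 * t + 1)"
    by (simp add: power2_eq_square algebra_simps)
  also have "\<dots> \<ge> 0" using assms by simp
  finally show ?thesis by simp
qed

text \<open>For \<open>s = l = 0\<close> the maximum is at \<open>t = 3 / 4\<close>, that is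
  \<open>r = 8 * m / 3\<close>, and equals \<open>27 / 256\<close>; the scaling by 1024 produces
  \<open>4 * 27\<close>.\<close>

lemma monopole_bound:
  fixes t :: real
  assumes "0 \<le> t"
  shows "1024 * (t ^ 2 * (1 - t) * t) \<le> 108"
proof -
  have "108 - 1024 * (t ^ 2 * (1 - t) * t) = 4 * ((4 * t - 3) ^ 2 * (16 * t ^ 2 + 8 * t + 3))"
    by (simp add: power2_eq_square algebra_simps)
  also have "\<dots> \<ge> 0" using assms by simp
  finally show ?thesis by simp
qed

text \<open>This is the case \<open>s = 0\<close>, \<open>l = 1\<close>, the tightest one for the
  uniform bound: the quartic reaches about 0.397, just below \<open>2 / 5\<close>.\<close>

lemma dipole_bound:
  fixes t :: real
  assumes "0 \<le> t" "t \<le> 1"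
  shows "5 * (t ^ 2 * (1 - t) * (2 + t)) < 2"
proof -
  \<comment> \<open>The maximum is at \<open>t = (sqrt 73 - 3) / 8\<close>, which \<open>9 / 13\<close> approximates.\<close>
  have "2 - 5 * (t ^ 2 * (1 - t) * (2 + t))
      = (t - 9 / 13) ^ 2 * (5 * t ^ 2 + (155 / 13) * t + 695 / 169) + (827 / 28561 - 45 / 2197 * t)"
    by (simp add: power2_eq_square algebra_simps)
  also have "\<dots> > 0" using assms by (intro add_nonneg_pos mult_nonneg_nonneg add_nonneg_nonneg) auto
  finally show ?thesis by simp
qed

lemma photon_sphere_bound_strict:
  fixes t L \<sigma> :: real
  assumes "0 < t" "t < 1" "L \<ge> 0" "\<sigma> < 0"
  shows "27 * (t ^ 2 * (1 - t) * (L + \<sigma> * t)) < 4 * L"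
proof -
  have "27 * (t ^ 2 * (1 - t) * (L + \<sigma> * t)) < 27 * (t ^ 2 * (1 - t) * L)"
    using assms by (simp add: mult_neg_pos)
  also have "\<dots> = 27 * (t ^ 2 * (1 - t)) * L" by simp
  also have "\<dots> \<le> 4 * L" using assms by (intro mult_right_mono photon_sphere_bound) auto
  finally show ?thesis .
qed

text \<open>Raising the last \<open>t\<close> to 1 reduces to the photon sphere bound with
  \<open>L + 1\<close>, which is \<open>l^2 + l + 1\<close>; this loss gives strictness.\<close>

lemma scalar_bound_strict:
  fixes t L :: real
  assumes "0 < t" "t < 1" "L \<ge> 0"
  shows "27 * (t ^ 2 * (1 - t) * (L + t)) < 4 * (L + 1)"
proof -
  have "27 * (t ^ 2 * (1 - t) * (L + t)) < 27 * (t ^ 2 * (1 - t) * (L + 1))"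
    using assms by simp
  also have "\<dots> = 27 * (t ^ 2 * (1 - t)) * (L + 1)" by simp
  also have "\<dots> \<le> 4 * (L + 1)" using assms by (intro mult_right_mono photon_sphere_bound) auto
  finally show ?thesis .
qed

text \<open>Raising \<open>\<sigma>\<close> to 1 leaves the ratio \<open>(L + t) / L\<close>, which
  falls as \<open>L\<close> grows, so \<open>L = 2\<close> is the worst case.\<close>

lemma uniform_bound_strict:
  fixes t L \<sigma> :: real
  assumes t: "0 < t" "t < 1" and L: "L \<ge> 2" and \<sigma>: "\<sigma> \<le> 1"
  shows "20 * (t ^ 2 * (1 - t) * (L + \<sigma> * t)) < 4 * L"
proof -
  have "L * t \<ge> 2 * t" "\<sigma> * t \<le> t" using assms by (simp_all add: mult_right_mono)
  then have "L + \<sigma> * t \<le> (2 + t) * (L / 2)" by (simp add: distrib_right distrib_left algebra_simps)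
  then have "20 * (t ^ 2 * (1 - t) * (L + \<sigma> * t)) \<le> 20 * (t ^ 2 * (1 - t) * ((2 + t) * (L / 2)))"
    using t by (intro mult_left_mono) auto
  also have "\<dots> = 5 * (t ^ 2 * (1 - t) * (2 + t)) * (2 * L)" by simp
  also have "\<dots> < 2 * (2 * L)"
    using L t by (intro mult_strict_right_mono dipole_bound) auto
  finally show ?thesis by simp
qed

theorem mainTheorem6:
  fixes m \<omega> :: real and s l :: nat
  assumes "m > 0" and "\<omega> > 0" and "s \<le> l"
  shows
    "(s = 1 \<and> 108 * \<omega> ^ 2 * m ^ 2 * (27 * \<omega> ^ 2 * m ^ 2 - real l * (real l + 1)) > 0 \<longrightarrow>
           greybody_factor m \<omega> s l \<ge>
             108 * \<omega> ^ 2 * m ^ 2 * (27 * \<omega> ^ 2 * m ^ 2 - real l * (real l + 1)) / (54 * \<omega> ^ 2 * m ^ 2 - real l * (real l + 1)) ^ 2) \<and>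
     (s = 0 \<and> l = 0 \<and> 4096 * \<omega> ^ 2 * m ^ 2 * (1024 * \<omega> ^ 2 * m ^ 2 - 27) > 0 \<longrightarrow>
           greybody_factor m \<omega> s l \<ge>
             4096 * \<omega> ^ 2 * m ^ 2 * (1024 * \<omega> ^ 2 * m ^ 2 - 27) / (2048 * \<omega> ^ 2 * m ^ 2 - 27) ^ 2) \<and>
     (s = 0 \<and> l \<ge> 1 \<and> 108 * \<omega> ^ 2 * m ^ 2 * (27 * \<omega> ^ 2 * m ^ 2 - ((real l) ^ 2 + real l + 1)) > 0 \<longrightarrow>
           greybody_factor m \<omega> s l >
             108 * \<omega> ^ 2 * m ^ 2 * (27 * \<omega> ^ 2 * m ^ 2 - ((real l) ^ 2 + real l + 1)) / (54 * \<omega> ^ 2 * m ^ 2 - ((real l) ^ 2 + real l + 1)) ^ 2) \<and>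
     (s > 1 \<and> 108 * \<omega> ^ 2 * m ^ 2 * (27 * \<omega> ^ 2 * m ^ 2 - real l * (real l + 1)) > 0 \<longrightarrow>
           greybody_factor m \<omega> s l >
             108 * \<omega> ^ 2 * m ^ 2 * (27 * \<omega> ^ 2 * m ^ 2 - real l * (real l + 1)) / (54 * \<omega> ^ 2 * m ^ 2 - real l * (real l + 1)) ^ 2) \<and>
     ((s, l) \<noteq> (0, 0) \<and> 80 * \<omega> ^ 2 * m ^ 2 * (20 * \<omega> ^ 2 * m ^ 2 - real l * (real l + 1)) > 0 \<longrightarrow>
           greybody_factor m \<omega> s l >
             80 * \<omega> ^ 2 * m ^ 2 * (20 * \<omega> ^ 2 * m ^ 2 - real l * (real l + 1)) / (40 * \<omega> ^ 2 * m ^ 2 - real l * (real l + 1)) ^ 2)"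
proof (intro conjI impI; elim conjE)
  assume "s = 1" and num: "108 * \<omega> ^ 2 * m ^ 2 * (27 * \<omega> ^ 2 * m ^ 2 - real l * (real l + 1)) > 0"
  show "greybody_factor m \<omega> s l \<ge>
      108 * \<omega> ^ 2 * m ^ 2 * (27 * \<omega> ^ 2 * m ^ 2 - real l * (real l + 1)) / (54 * \<omega> ^ 2 * m ^ 2 - real l * (real l + 1)) ^ 2"
  proof (rule greybody_factor_ge(1)[OF assms _ _ _ num])
    fix t :: real assume "0 < t" "t < 1"
    then have "27 * (t ^ 2 * (1 - t)) * (real l * (real l + 1)) \<le> 4 * (real l * (real l + 1))"
      by (intro mult_right_mono photon_sphere_bound) auto
    then show "27 * (t ^ 2 * (1 - t) * (real l * (real l + 1) + (1 - (real s) ^ 2) * t)) \<le> 4 * (real l * (real l + 1))"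
      using \<open>s = 1\<close> by (simp only: of_nat_1 power_one diff_self mult_zero_left add_0_right mult.assoc)
  qed auto
next
  assume "s = 0" "l = 0" and num: "4096 * \<omega> ^ 2 * m ^ 2 * (1024 * \<omega> ^ 2 * m ^ 2 - 27) > 0"
  show "greybody_factor m \<omega> s l \<ge>
      4096 * \<omega> ^ 2 * m ^ 2 * (1024 * \<omega> ^ 2 * m ^ 2 - 27) / (2048 * \<omega> ^ 2 * m ^ 2 - 27) ^ 2"
  proof (rule greybody_factor_ge(1)[OF assms _ _ _ num])
    show "1024 * (t ^ 2 * (1 - t) * (real l * (real l + 1) + (1 - (real s) ^ 2) * t)) \<le> 4 * 27" if "0 < t" "t < 1" for t
      using monopole_bound[of t] that \<open>s = 0\<close> \<open>l = 0\<close> by simp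
  qed auto
next
  assume "s = 0" and num: "108 * \<omega> ^ 2 * m ^ 2 * (27 * \<omega> ^ 2 * m ^ 2 - ((real l) ^ 2 + real l + 1)) > 0"
  show "greybody_factor m \<omega> s l >
      108 * \<omega> ^ 2 * m ^ 2 * (27 * \<omega> ^ 2 * m ^ 2 - ((real l) ^ 2 + real l + 1)) / (54 * \<omega> ^ 2 * m ^ 2 - ((real l) ^ 2 + real l + 1)) ^ 2"
  proof (rule greybody_factor_ge(2)[OF assms _ _ _ num])
    fix t :: real assume t: "0 < t" "t < 1"
    have "real l * (real l + 1) + 1 = (real l) ^ 2 + real l + 1"
      by (simp add: power2_eq_square distrib_left)
    with scalar_bound_strict[OF t, of "real l * (real l + 1)"]
    show "27 * (t ^ 2 * (1 - t) * (real l * (real l + 1) + (1 - (real s) ^ 2) * t)) < 4 * ((real l) ^ 2 + real l + 1)"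
      using \<open>s = 0\<close> by simp
  qed auto
next
  assume "s > 1" and num: "108 * \<omega> ^ 2 * m ^ 2 * (27 * \<omega> ^ 2 * m ^ 2 - real l * (real l + 1)) > 0"
  show "greybody_factor m \<omega> s l >
      108 * \<omega> ^ 2 * m ^ 2 * (27 * \<omega> ^ 2 * m ^ 2 - real l * (real l + 1)) / (54 * \<omega> ^ 2 * m ^ 2 - real l * (real l + 1)) ^ 2"
  proof (rule greybody_factor_ge(2)[OF assms _ _ _ num])
    have "1 - (real s) ^ 2 < 0" using \<open>s > 1\<close> by simp
    then show "27 * (t ^ 2 * (1 - t) * (real l * (real l + 1) + (1 - (real s) ^ 2) * t)) < 4 * (real l * (real l + 1))"
      if "0 < t" "t < 1" for t
      using that by (intro photon_sphere_bound_strict) auto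
  qed auto
next
  assume "(s, l) \<noteq> (0, 0)" and num: "80 * \<omega> ^ 2 * m ^ 2 * (20 * \<omega> ^ 2 * m ^ 2 - real l * (real l + 1)) > 0"
  show "greybody_factor m \<omega> s l >
      80 * \<omega> ^ 2 * m ^ 2 * (20 * \<omega> ^ 2 * m ^ 2 - real l * (real l + 1)) / (40 * \<omega> ^ 2 * m ^ 2 - real l * (real l + 1)) ^ 2"
  proof (rule greybody_factor_ge(2)[OF assms _ _ _ num])
    have "l \<ge> 1" using \<open>(s, l) \<noteq> (0, 0)\<close> \<open>s \<le> l\<close> by auto
    then have "real l * (real l + 1) \<ge> 1 * (1 + 1)" by (intro mult_mono) auto
    then show "20 * (t ^ 2 * (1 - t) * (real l * (real l + 1) + (1 - (real s) ^ 2) * t)) < 4 * (real l * (real l + 1))"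
      if "0 < t" "t < 1" for t
      using that by (intro uniform_bound_strict) auto
  qed auto
qed

end
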